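(* Let $X$ be a metric space and $Y$ a subset of $X$. Then the positively closed sublocale $\overline{Y}$ of $\mathrm{loc}(X)$ defined by $\mathrm{Pos}_Y$ is a located sublocale of $\mathrm{loc}(X)$ if and only if $Y$ is located as a subset of $X$.
   Context: Everything is constructive and predicative: intuitionistic logic, no axiom of choice (not even countable choice). A metric space is a set $X$ with a ternary relation $d(x,y)<r$ ($x,y\in X$, $r\in\mathbb{Q}^{>0}$) such that: for all $x,y$ there is $r$ with $d(x,y)<r$; if $d(x,y)<r$ then $d(x,y)<s$ for some $s<r$; $d(x,y)<r$ for all $r>0$ iff $x=y$; $d(x,y)<r$ iff $d(y,x)<r$; $d(x,y)<r$ and $d(y,z)<s$ imply $d(x,z)<r+s$. For rational $q\le 0$, "$d(x,y)<q$" is false. A subset $A\subseteq X$ is located if for all $x\in X$ and rationals $s<t$ either there is $y\in A$ with $d(x,y)<t$, or there is no $y\in A$ with $d(x,y)<s$. A formal topology is a preorder $(S,\le)$ with a covering relation $\vartriangleleft$ between elements and subsets of $S$ such that: (Ref) $a\in U$ implies $a\vartriangleleft U$; (Tra) $a\vartriangleleft U$ and $U\vartriangleleft V$ imply $a\vartriangleleft V$, where $U\vartriangleleft V$ means $u\vartriangleleft V$ for all $u\in U$; (Loc) $a\vartriangleleft U$ and $a\vartriangleleft V$ imply $a\vartriangleleft\{x:\exists u\in U\,\exists v\in V\;(x\le u,\ x\le v)\}$; (Ext) $a\le b$ implies $a\vartriangleleft\{b\}$. A sublocale is given by a covering relation on $(S,\le)$ containing $\vartriangleleft$. A subset $F\subseteq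 S$ is positively closed if $F(u)$ and $u\vartriangleleft V$ imply $F(v)$ for some $v\in V$; the positively closed sublocale defined by $F$ is given by the least covering relation $\vartriangleleft_F$ containing $\vartriangleleft$ with $u\vartriangleleft_F\{u' : u'=u\text{ and }F(u)\}$ for all $u$. The localic completion $\mathrm{loc}(X)$ is the formal topology with $S=\{B_r(x):x\in X,\ r\in\mathbb{Q}^{>0}\}$ (formal balls, i.e. pairs $(x,r)$), $B_r(x)<B_s(y)$ iff $d(x,y)<s-r$, $B_r(x)\le B_s(y)$ iff $d(x,y)<t$ for all rational $t>s-r$, and $\vartriangleleft$ the covering relation inductively generated by (M1) $u\vartriangleleft\{v:v<u\}$ and (M2) $S\vartriangleleft\{B_r(x):x\in X\}$ for every $r$. $\mathrm{Pos}_Y$ is the (positively closed) set of all balls $B_r(x)$ for which there is $y\in Y$ with $d(x,y)<r$. A positively closed predicate $\mathrm{Pos}$ on $S$ is located if $v<u$ implies $\neg\mathrm{Pos}(v)$ or $\mathrm{Pos}(u)$. A positively closed sublocale is located if it is the positively closed sublocale defined by some located predicate. *)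

theory Defs
  imports Complex_Main
begin

unbundle lattice_syntax

text \<open>
  The mathematics formalised here is intuitionistic; read in the classical logic of HOL, both
  notions of locatedness would hold for every subset. All formulas are therefore interpreted
  with truth values in an arbitrary frame (complete Heyting algebra) \<^typ>\<open>'h\<close>: a set is an
  \<^typ>\<open>'h\<close>-valued set, a subset or relation is an extensional \<^typ>\<open>'h\<close>-valued predicate,
  connectives and quantifiers are the operations of the frame, and quantification over subsets
  and covering relations ranges over the corresponding power objects. This is the
  standard interpretation of intuitionistic higher-order logic in the topos of sheaves on the
  frame. Taking \<^typ>\<open>bool\<close> for the frame gives back the ordinary reading in HOL.
\<close>


section \<open>Frame-valued logic\<close>

class frame = complete_lattice +
  assumes inf_Sup_le: "a \<sqinter> \<Squnion>B \<le> (\<Squnion>b\<in>B. a \<sqinter> b)"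

instance bool :: frame
  by standard auto

abbreviation h_and :: "'h::frame \<Rightarrow> 'h \<Rightarrow> 'h"  (infixr "\<^bold>\<and>" 35)
  where "p \<^bold>\<and> q \<equiv> p \<sqinter> q"

abbreviation h_or :: "'h::frame \<Rightarrow> 'h \<Rightarrow> 'h"  (infixr "\<^bold>\<or>" 30)
  where "p \<^bold>\<or> q \<equiv> p \<squnion> q"

definition h_imp :: "'h::frame \<Rightarrow> 'h \<Rightarrow> 'h"  (infixr "\<^bold>\<longrightarrow>" 25)
  where "(p \<^bold>\<longrightarrow> q) = \<Squnion>{c. c \<sqinter> p \<le> q}"

abbreviation h_iff :: "'h::frame \<Rightarrow> 'h \<Rightarrow> 'h"  (infixr "\<^bold>\<longleftrightarrow>" 25)
  where "p \<^bold>\<longleftrightarrow> q \<equiv> (p \<^bold>\<longrightarrow> q) \<^bold>\<and> (q \<^bold>\<longrightarrow> p)"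

abbreviation h_not :: "'h::frame \<Rightarrow> 'h"  ("\<^bold>\<not> _" [40] 40)
  where "\<^bold>\<not> p \<equiv> p \<^bold>\<longrightarrow> \<bottom>"

definition h_all :: "('a \<Rightarrow> 'h::frame) \<Rightarrow> ('a \<Rightarrow> 'h) \<Rightarrow> 'h"
  where "h_all A P = (\<Sqinter>x. A x \<^bold>\<longrightarrow> P x)"

definition h_ex :: "('a \<Rightarrow> 'h::frame) \<Rightarrow> ('a \<Rightarrow> 'h) \<Rightarrow> 'h"
  where "h_ex A P = (\<Squnion>x. A x \<^bold>\<and> P x)"

syntax
  "_h_all" :: "pttrn \<Rightarrow> ('a \<Rightarrow> 'h) \<Rightarrow> 'h \<Rightarrow> 'h"  ("(3\<^bold>\<forall>_\<^bold>\<in>_./ _)" [0, 51, 10] 10)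
  "_h_ex"  :: "pttrn \<Rightarrow> ('a \<Rightarrow> 'h) \<Rightarrow> 'h \<Rightarrow> 'h"  ("(3\<^bold>\<exists>_\<^bold>\<in>_./ _)" [0, 51, 10] 10)
translations
  "\<^bold>\<forall>x\<^bold>\<in>A. P" \<rightleftharpoons> "CONST h_all A (\<lambda>x. P)"
  "\<^bold>\<exists>x\<^bold>\<in>A. P" \<rightleftharpoons> "CONST h_ex A (\<lambda>x. P)"

definition valid :: "'h::frame \<Rightarrow> bool"  ("\<Turnstile> _" [10] 10)
  where "(\<Turnstile> p) \<longleftrightarrow> p = \<top>"

lemma le_h_imp_iff: "c \<le> (p \<^bold>\<longrightarrow> q) \<longleftrightarrow> c \<sqinter> p \<le> q"
proof
  assume c: "c \<le> (p \<^bold>\<longrightarrow> q)"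
  have "c \<sqinter> p \<le> p \<sqinter> \<Squnion>{c. c \<sqinter> p \<le> q}"
    using c by (auto simp: h_imp_def intro: le_infI1)
  also have "\<dots> \<le> (\<Squnion>b\<in>{c. c \<sqinter> p \<le> q}. p \<sqinter> b)"
    by (rule inf_Sup_le)
  also have "\<dots> \<le> q"
    by (auto intro!: SUP_least simp: inf_commute)
  finally show "c \<sqinter> p \<le> q" .
next
  assume "c \<sqinter> p \<le> q"
  then show "c \<le> (p \<^bold>\<longrightarrow> q)"
    unfolding h_imp_def by (intro Sup_upper) simp
qed

lemma h_imp_bool [simp]: "(p \<^bold>\<longrightarrow> q) = (p \<longrightarrow> q)" for p q :: bool
  by (auto simp: h_imp_def)

lemma h_all_bool: "(\<^bold>\<forall>x\<^bold>\<in>A. P x) = (\<forall>x. A x \<longrightarrow> P x)" for P :: "'a \<Rightarrow> bool"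
  by (simp add: h_all_def)

lemma h_ex_bool: "(\<^bold>\<exists>x\<^bold>\<in>A. P x) = (\<exists>x. A x \<and> P x)" for P :: "'a \<Rightarrow> bool"
  by (simp add: h_ex_def)

lemma valid_bool: "(\<Turnstile> p) = p" for p :: bool
  by (simp add: valid_def)


section \<open>Frame-valued sets\<close>

text \<open>
  A frame-valued set is given by its equality \<open>eq\<close>. The extent \<open>eq x x\<close> is the truth value of
  ``\<open>x\<close> is an element''; it may be smaller than \<open>\<top>\<close>, so partial elements and empty sets are
  covered.
\<close>

definition hset :: "('a \<Rightarrow> 'a \<Rightarrow> 'h::frame) \<Rightarrow> bool"
  where "hset eq \<longleftrightarrow>
    (\<forall>x y. eq x y \<le> eq y x) \<and> (\<forall>x y z. eq x y \<sqinter> eq y z \<le> eq x z)"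

abbreviation ext :: "('a \<Rightarrow> 'a \<Rightarrow> 'h) \<Rightarrow> 'a \<Rightarrow> 'h"
  where "ext eq x \<equiv> eq x x"

definition subsets :: "('a \<Rightarrow> 'a \<Rightarrow> 'h::frame) \<Rightarrow> ('a \<Rightarrow> 'h) set"
  where "subsets eq =
    {U. (\<forall>x. U x \<le> ext eq x) \<and> (\<forall>x y. U x \<sqinter> eq x y \<le> U y)}"

definition subset_eq :: "('a \<Rightarrow> 'h::frame) \<Rightarrow> ('a \<Rightarrow> 'h) \<Rightarrow> 'h"
  where "subset_eq U V = (\<Sqinter>x. U x \<^bold>\<longleftrightarrow> V x)"

text \<open>Relations between elements and subsets of a frame-valued set.\<close>

definition elem_subset_rels :: "('a \<Rightarrow> 'a \<Rightarrow> 'h::frame) \<Rightarrow> ('a \<Rightarrow> ('a \<Rightarrow> 'h) \<Rightarrow> 'h) set"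
  where "elem_subset_rels eq =
    {R. (\<forall>a. \<forall>U\<in>subsets eq. R a U \<le> ext eq a) \<and>
        (\<forall>a b. \<forall>U\<in>subsets eq. \<forall>V\<in>subsets eq. R a U \<sqinter> eq a b \<sqinter> subset_eq U V \<le> R b V)}"


section \<open>Metric spaces and located subsets\<close>

text \<open>
  \<open>d x y r\<close> is the truth value of \<open>d(x,y) < r\<close>. Rational numbers are quantified externally,
  since their order is decidable.
\<close>

definition distance_rel :: "('x \<Rightarrow> 'x \<Rightarrow> 'h::frame) \<Rightarrow> ('x \<Rightarrow> 'x \<Rightarrow> rat \<Rightarrow> 'h) \<Rightarrow> bool"
  where "distance_rel eq d \<longleftrightarrow>
    (\<forall>x y r. d x y r \<le> ext eq x \<sqinter> ext eq y) \<and>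
    (\<forall>x x' y y' r. d x y r \<sqinter> eq x x' \<sqinter> eq y y' \<le> d x' y' r) \<and>
    (\<forall>x y r. r \<le> 0 \<longrightarrow> d x y r = \<bottom>)"

definition is_metric :: "('x \<Rightarrow> 'x \<Rightarrow> 'h::frame) \<Rightarrow> ('x \<Rightarrow> 'x \<Rightarrow> rat \<Rightarrow> 'h) \<Rightarrow> 'h"
  where "is_metric eq d =
    ((\<^bold>\<forall>x\<^bold>\<in>ext eq. \<^bold>\<forall>y\<^bold>\<in>ext eq. \<Squnion>r\<in>{0<..}. d x y r) \<^bold>\<and>
     (\<^bold>\<forall>x\<^bold>\<in>ext eq. \<^bold>\<forall>y\<^bold>\<in>ext eq. \<Sqinter>r\<in>{0<..}. d x y r \<^bold>\<longrightarrow> (\<Squnion>s\<in>{0<..<r}. d x y s)) \<^bold>\<and>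
     (\<^bold>\<forall>x\<^bold>\<in>ext eq. \<^bold>\<forall>y\<^bold>\<in>ext eq. (\<Sqinter>r\<in>{0<..}. d x y r) \<^bold>\<longleftrightarrow> eq x y) \<^bold>\<and>
     (\<^bold>\<forall>x\<^bold>\<in>ext eq. \<^bold>\<forall>y\<^bold>\<in>ext eq. \<Sqinter>r\<in>{0<..}. d x y r \<^bold>\<longleftrightarrow> d y x r) \<^bold>\<and>
     (\<^bold>\<forall>x\<^bold>\<in>ext eq. \<^bold>\<forall>y\<^bold>\<in>ext eq. \<^bold>\<forall>z\<^bold>\<in>ext eq. \<Sqinter>r\<in>{0<..}. \<Sqinter>s\<in>{0<..}.
        d x y r \<^bold>\<and> d y z s \<^bold>\<longrightarrow> d x z (r + s)))"

definition located_subset ::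
    "('x \<Rightarrow> 'x \<Rightarrow> 'h::frame) \<Rightarrow> ('x \<Rightarrow> 'x \<Rightarrow> rat \<Rightarrow> 'h) \<Rightarrow> ('x \<Rightarrow> 'h) \<Rightarrow> 'h"
  where "located_subset eq d A =
    (\<^bold>\<forall>x\<^bold>\<in>ext eq. \<Sqinter>s. \<Sqinter>t\<in>{s<..}. (\<^bold>\<exists>y\<^bold>\<in>A. d x y t) \<^bold>\<or> \<^bold>\<not> (\<^bold>\<exists>y\<^bold>\<in>A. d x y s))"


section \<open>Covering relations and sublocales\<close>

definition covers :: "('s \<Rightarrow> ('s \<Rightarrow> 'h) \<Rightarrow> 'h) \<Rightarrow> ('s \<Rightarrow> 'h::frame) \<Rightarrow> ('s \<Rightarrow> 'h) \<Rightarrow> 'h"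
  where "covers R U V = (\<^bold>\<forall>u\<^bold>\<in>U. R u V)"

definition common_refinement ::
    "('s \<Rightarrow> 's \<Rightarrow> 'h::frame) \<Rightarrow> ('s \<Rightarrow> 'h) \<Rightarrow> ('s \<Rightarrow> 'h) \<Rightarrow> 's \<Rightarrow> 'h"
  where "common_refinement le U V x = (\<^bold>\<exists>u\<^bold>\<in>U. \<^bold>\<exists>v\<^bold>\<in>V. le x u \<^bold>\<and> le x v)"

text \<open>The axioms (Ref), (Tra), (Loc) and (Ext) for a relation \<open>R\<close> on the preorder \<open>le\<close>.\<close>

definition is_covering ::
    "('s \<Rightarrow> 's \<Rightarrow> 'h::frame) \<Rightarrow> ('s \<Rightarrow> 's \<Rightarrow> 'h) \<Rightarrow> ('s \<Rightarrow> ('s \<Rightarrow> 'h) \<Rightarrow> 'h) \<Rightarrow> 'h"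
  where "is_covering eq le R =
    ((\<^bold>\<forall>a\<^bold>\<in>ext eq. \<Sqinter>U\<in>subsets eq. U a \<^bold>\<longrightarrow> R a U) \<^bold>\<and>
     (\<^bold>\<forall>a\<^bold>\<in>ext eq. \<Sqinter>U\<in>subsets eq. \<Sqinter>V\<in>subsets eq. R a U \<^bold>\<and> covers R U V \<^bold>\<longrightarrow> R a V) \<^bold>\<and>
     (\<^bold>\<forall>a\<^bold>\<in>ext eq. \<Sqinter>U\<in>subsets eq. \<Sqinter>V\<in>subsets eq.
        R a U \<^bold>\<and> R a V \<^bold>\<longrightarrow> R a (common_refinement le U V)) \<^bold>\<and>
     (\<^bold>\<forall>a\<^bold>\<in>ext eq. \<^bold>\<forall>b\<^bold>\<in>ext eq. le a b \<^bold>\<longrightarrow> R a (\<lambda>c. eq c b)))"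

text \<open>
  The least covering relation with property \<open>P\<close>, as the intersection (in the internal logic) of
  all of them; both inductively generated covers and sublocales are instances.
\<close>

definition least_covering ::
    "('s \<Rightarrow> 's \<Rightarrow> 'h::frame) \<Rightarrow> ('s \<Rightarrow> 's \<Rightarrow> 'h) \<Rightarrow> (('s \<Rightarrow> ('s \<Rightarrow> 'h) \<Rightarrow> 'h) \<Rightarrow> 'h)
      \<Rightarrow> 's \<Rightarrow> ('s \<Rightarrow> 'h) \<Rightarrow> 'h"
  where "least_covering eq le P a U =
    (\<Sqinter>R\<in>elem_subset_rels eq. is_covering eq le R \<^bold>\<and> P R \<^bold>\<longrightarrow> R a U)"

definition covering_subset ::
    "('s \<Rightarrow> 's \<Rightarrow> 'h::frame) \<Rightarrow> ('s \<Rightarrow> ('s \<Rightarrow> 'h) \<Rightarrow> 'h) \<Rightarrow> ('s \<Rightarrow> ('s \<Rightarrow> 'h) \<Rightarrow> 'h) \<Rightarrow> 'h"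
  where "covering_subset eq R R' = (\<^bold>\<forall>a\<^bold>\<in>ext eq. \<Sqinter>U\<in>subsets eq. R a U \<^bold>\<longrightarrow> R' a U)"

definition positively_closed ::
    "('s \<Rightarrow> 's \<Rightarrow> 'h::frame) \<Rightarrow> ('s \<Rightarrow> ('s \<Rightarrow> 'h) \<Rightarrow> 'h) \<Rightarrow> ('s \<Rightarrow> 'h) \<Rightarrow> 'h"
  where "positively_closed eq cov F =
    (\<^bold>\<forall>u\<^bold>\<in>ext eq. \<Sqinter>V\<in>subsets eq. F u \<^bold>\<and> cov u V \<^bold>\<longrightarrow> (\<^bold>\<exists>v\<^bold>\<in>V. F v))"

definition poscl_sublocale ::
    "('s \<Rightarrow> 's \<Rightarrow> 'h::frame) \<Rightarrow> ('s \<Rightarrow> 's \<Rightarrow> 'h) \<Rightarrow> ('s \<Rightarrow> ('s \<Rightarrow> 'h) \<Rightarrow> 'h) \<Rightarrow> ('s \<Rightarrow> 'h)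
      \<Rightarrow> 's \<Rightarrow> ('s \<Rightarrow> 'h) \<Rightarrow> 'h"
  where "poscl_sublocale eq le cov F =
    least_covering eq le
      (\<lambda>R. covering_subset eq cov R \<^bold>\<and> (\<^bold>\<forall>u\<^bold>\<in>ext eq. R u (\<lambda>u'. eq u' u \<^bold>\<and> F u)))"


section \<open>The localic completion\<close>

text \<open>
  The formal ball of centre \<open>x\<close> and radius \<open>r\<close> is the pair \<open>(x, r)\<close>; pairs with \<open>r \<le> 0\<close> have
  extent \<open>\<bottom>\<close>, i.e. they are not elements of the set of formal balls.
\<close>

type_synonym 'x ball = "'x \<times> rat"

fun ball_eq :: "('x \<Rightarrow> 'x \<Rightarrow> 'h::frame) \<Rightarrow> 'x ball \<Rightarrow> 'x ball \<Rightarrow> 'h"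
  where "ball_eq eq (x, r) (y, s) = (if 0 < r \<and> r = s then eq x y else \<bottom>)"

fun ball_less :: "('x \<Rightarrow> 'x \<Rightarrow> rat \<Rightarrow> 'h::frame) \<Rightarrow> 'x ball \<Rightarrow> 'x ball \<Rightarrow> 'h"
  where "ball_less d (x, r) (y, s) = (if 0 < r \<and> 0 < s then d x y (s - r) else \<bottom>)"

fun ball_le :: "('x \<Rightarrow> 'x \<Rightarrow> rat \<Rightarrow> 'h::frame) \<Rightarrow> 'x ball \<Rightarrow> 'x ball \<Rightarrow> 'h"
  where "ball_le d (x, r) (y, s) = (if 0 < r \<and> 0 < s then \<Sqinter>t\<in>{s - r<..}. d x y t else \<bottom>)"

text \<open>The axioms (M1) and (M2).\<close>

definition loc_axioms ::
    "('x \<Rightarrow> 'x \<Rightarrow> 'h::frame) \<Rightarrow> ('x \<Rightarrow> 'x \<Rightarrow> rat \<Rightarrow> 'h) \<Rightarrow> ('x ball \<Rightarrow> ('x ball \<Rightarrow> 'h) \<Rightarrow> 'h) \<Rightarrow> 'h"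
  where "loc_axioms eq d R =
    ((\<^bold>\<forall>u\<^bold>\<in>ext (ball_eq eq). R u (\<lambda>v. ball_less d v u)) \<^bold>\<and>
     (\<Sqinter>r\<in>{0<..}. covers R (ext (ball_eq eq)) (\<lambda>b. \<^bold>\<exists>x\<^bold>\<in>ext eq. ball_eq eq b (x, r))))"

definition loc_cover ::
    "('x \<Rightarrow> 'x \<Rightarrow> 'h::frame) \<Rightarrow> ('x \<Rightarrow> 'x \<Rightarrow> rat \<Rightarrow> 'h) \<Rightarrow> 'x ball \<Rightarrow> ('x ball \<Rightarrow> 'h) \<Rightarrow> 'h"
  where "loc_cover eq d = least_covering (ball_eq eq) (ball_le d) (loc_axioms eq d)"

definition loc_sublocale ::
    "('x \<Rightarrow> 'x \<Rightarrow> 'h::frame) \<Rightarrow> ('x \<Rightarrow> 'x \<Rightarrow> rat \<Rightarrow> 'h) \<Rightarrow> ('x ball \<Rightarrow> 'h)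
      \<Rightarrow> 'x ball \<Rightarrow> ('x ball \<Rightarrow> 'h) \<Rightarrow> 'h"
  where "loc_sublocale eq d F = poscl_sublocale (ball_eq eq) (ball_le d) (loc_cover eq d) F"

definition Pos :: "('x \<Rightarrow> 'x \<Rightarrow> 'h::frame) \<Rightarrow> ('x \<Rightarrow> 'x \<Rightarrow> rat \<Rightarrow> 'h) \<Rightarrow> ('x \<Rightarrow> 'h) \<Rightarrow> 'x ball \<Rightarrow> 'h"
  where "Pos eq d Y b = (ext (ball_eq eq) b \<^bold>\<and> (\<^bold>\<exists>y\<^bold>\<in>Y. d (fst b) y (snd b)))"

definition located_pred ::
    "('x \<Rightarrow> 'x \<Rightarrow> 'h::frame) \<Rightarrow> ('x \<Rightarrow> 'x \<Rightarrow> rat \<Rightarrow> 'h) \<Rightarrow> ('x ball \<Rightarrow> 'h) \<Rightarrow> 'h"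
  where "located_pred eq d F =
    (positively_closed (ball_eq eq) (loc_cover eq d) F \<^bold>\<and>
     (\<^bold>\<forall>u\<^bold>\<in>ext (ball_eq eq). \<^bold>\<forall>v\<^bold>\<in>ext (ball_eq eq). ball_less d v u \<^bold>\<longrightarrow> \<^bold>\<not> F v \<^bold>\<or> F u))"

text \<open>
  A sublocale, given by its covering relation \<open>R\<close>, is located if it is the positively closed
  sublocale defined by some located predicate.
\<close>

definition located_sublocale ::
    "('x \<Rightarrow> 'x \<Rightarrow> 'h::frame) \<Rightarrow> ('x \<Rightarrow> 'x \<Rightarrow> rat \<Rightarrow> 'h) \<Rightarrow> ('x ball \<Rightarrow> ('x ball \<Rightarrow> 'h) \<Rightarrow> 'h) \<Rightarrow> 'h"
  where "located_sublocale eq d R =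
    (\<Squnion>F\<in>subsets (ball_eq eq). located_pred eq d F \<^bold>\<and>
       covering_subset (ball_eq eq) R (loc_sublocale eq d F) \<^bold>\<and>
       covering_subset (ball_eq eq) (loc_sublocale eq d F) R)"

end

theory Submission
  imports Defs
begin

text \<open>
  The argument has two halves: one about an arbitrary formal topology and one about metric spaces.

  In any formal topology, a positively closed predicate \<open>F\<close> can be recovered from the sublocale it
  defines. By construction \<open>u\<close> is covered in that sublocale by the part of \<open>{u}\<close> on which \<open>F u\<close>
  holds. So if the sublocale of \<open>F\<close> is contained in the sublocale of \<open>G\<close> (as covering relations),
  then this covering also holds for \<open>G\<close>; and if \<open>G\<close> is still positively closed for the larger
  covering relation, then \<open>G u\<close> makes the covering family inhabited, that is, \<open>F u\<close> holds
  (\<open>sublocale_subset_imp_predicate_subset\<close>). What has to be proved is that \<open>G\<close> remains positively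
  closed in its own sublocale. The sublocale is the least of many covering relations, so it suffices
  to exhibit one such relation for which \<open>G\<close> is visibly positively closed. The relation
  \<open>pos_cover G\<close> does this: \<open>V\<close> covers \<open>a\<close> when every \<open>G\<close>-positive \<open>b \<le> a\<close> has a \<open>G\<close>-positive
  refinement below some element of \<open>V\<close>. The refinements are built in so that (Loc) holds.

  The same relation shows that \<open>Pos\<close> is positively closed for the localic completion: a point
  \<open>y\<close> of \<open>Y\<close> in a ball has room around it, so sufficiently small balls around \<open>y\<close> lie strictly
  inside, which yields (M1) and (M2) for \<open>pos_cover\<close> of \<open>Pos\<close> (\<open>loc_axioms_pos_cover\<close>).

  Consequently the sublocale defined by \<open>Pos\<close> is located iff \<open>Pos\<close> itself is a located predicate,
  since any located predicate defining it must agree with \<open>Pos\<close>. That \<open>Pos\<close> is located means that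
  for \<open>d x z < s - r\<close> either no point of \<open>Y\<close> has distance less than \<open>r\<close> from \<open>x\<close>, or some point of
  \<open>Y\<close> has distance less than \<open>s\<close> from \<open>z\<close>. Concentric balls turn this into locatedness of \<open>Y\<close>, and
  the triangle inequality together with openness of the distance gives the converse.
\<close>


section \<open>Reasoning at a stage\<close>

text \<open>
  An inequality \<open>c \<le> p\<close> is read as ``\<open>p\<close> holds at stage \<open>c\<close>'', in the style of Kripke-Joyal
  semantics. Implications, universal quantifiers and eliminations of existential quantifiers and
  disjunctions pass to an arbitrary smaller stage, and facts are carried there by transitivity.
  With these rules an intuitionistic proof can be followed step by step; the distributive law of
  the frame enters only in the elimination rules and in the rule for implication.
\<close>

lemma forces_imp:
  fixes c :: "'h::frame"
  assumes "\<And>w. w \<le> c \<Longrightarrow> w \<le> p \<Longrightarrow> w \<le> q"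
  shows "c \<le> (p \<^bold>\<longrightarrow> q)"
  unfolding le_h_imp_iff by (rule assms) simp_all

lemma forces_mp:
  fixes c :: "'h::frame"
  assumes "c \<le> (p \<^bold>\<longrightarrow> q)" "c \<le> p"
  shows "c \<le> q"
proof -
  have "c \<le> c \<sqinter> p" using assms(2) by simp
  also have "\<dots> \<le> q" using assms(1) by (simp add: le_h_imp_iff)
  finally show ?thesis .
qed

lemma forces_all:
  fixes c :: "'h::frame"
  assumes "\<And>x w. w \<le> c \<Longrightarrow> w \<le> A x \<Longrightarrow> w \<le> P x"
  shows "c \<le> h_all A P"
  unfolding h_all_def by (intro INF_greatest forces_imp assms)

lemma forces_allD:
  fixes c :: "'h::frame"
  assumes "c \<le> h_all A P" "c \<le> A x"
  shows "c \<le> P x"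
proof (rule forces_mp)
  show "c \<le> (A x \<^bold>\<longrightarrow> P x)"
    using assms(1) unfolding h_all_def by (auto simp: le_INF_iff)
qed (rule assms(2))

lemma forces_INFD:
  fixes c :: "'h::complete_lattice"
  shows "c \<le> (\<Sqinter>i\<in>I. P i) \<Longrightarrow> i \<in> I \<Longrightarrow> c \<le> P i"
  by (simp add: le_INF_iff)

lemma forces_SUP:
  fixes c :: "'h::complete_lattice"
  shows "i \<in> I \<Longrightarrow> c \<le> P i \<Longrightarrow> c \<le> (\<Squnion>i\<in>I. P i)"
  by (rule SUP_upper2)

lemma forces_SUPE:
  fixes c :: "'h::frame"
  assumes "c \<le> (\<Squnion>i\<in>I. P i)"
    and "\<And>i w. i \<in> I \<Longrightarrow> w \<le> c \<Longrightarrow> w \<le> P i \<Longrightarrow> w \<le> q"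
  shows "c \<le> q"
proof -
  have "c \<le> c \<sqinter> (\<Squnion>i\<in>I. P i)" using assms(1) by simp
  also have "\<dots> \<le> (\<Squnion>b\<in>P ` I. c \<sqinter> b)" by (rule inf_Sup_le)
  also have "\<dots> \<le> q" by (auto intro!: SUP_least intro: assms(2))
  finally show ?thesis .
qed

lemma forces_ex:
  fixes c :: "'h::frame"
  shows "c \<le> A x \<Longrightarrow> c \<le> P x \<Longrightarrow> c \<le> h_ex A P"
  unfolding h_ex_def by (rule forces_SUP[of x]) simp_all

lemma forces_exE:
  fixes c :: "'h::frame"
  assumes "c \<le> h_ex A P"
    and "\<And>x w. w \<le> c \<Longrightarrow> w \<le> A x \<Longrightarrow> w \<le> P x \<Longrightarrow> w \<le> q"
  shows "c \<le> q"
  using assms(1) unfolding h_ex_def by (rule forces_SUPE) (auto intro: assms(2))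

lemma forces_orE:
  fixes c :: "'h::frame"
  assumes "c \<le> (p \<^bold>\<or> q)"
    and "\<And>w. w \<le> c \<Longrightarrow> w \<le> p \<Longrightarrow> w \<le> r"
    and "\<And>w. w \<le> c \<Longrightarrow> w \<le> q \<Longrightarrow> w \<le> r"
  shows "c \<le> r"
proof (rule forces_SUPE)
  show "c \<le> (\<Squnion>b\<in>{p, q}. b)" using assms(1) by simp
qed (use assms(2,3) in auto)

lemma forces_inf_le:
  fixes c :: "'h::semilattice_inf"
  shows "p \<sqinter> q \<le> r \<Longrightarrow> c \<le> p \<Longrightarrow> c \<le> q \<Longrightarrow> c \<le> r"
  by (rule order_trans[OF le_infI])


section \<open>Frame-valued sets\<close>

lemma hset_sym:
  assumes "hset eq" "w \<le> eq a b"
  shows "w \<le> eq b a"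
proof -
  have "eq a b \<le> eq b a" using assms(1) unfolding hset_def by simp
  with assms(2) show ?thesis by (rule order_trans)
qed

lemma hset_trans:
  assumes "hset eq" "w \<le> eq a b" "w \<le> eq b c"
  shows "w \<le> eq a c"
proof -
  have "eq a b \<sqinter> eq b c \<le> eq a c" using assms(1) unfolding hset_def by simp
  from this assms(2,3) show ?thesis by (rule forces_inf_le)
qed

lemma hset_ext: "hset eq \<Longrightarrow> w \<le> eq a b \<Longrightarrow> w \<le> ext eq a"
  by (rule hset_trans[OF _ _ hset_sym])

lemma subsets_ext: "U \<in> subsets eq \<Longrightarrow> w \<le> U x \<Longrightarrow> w \<le> ext eq x"
proof -
  assume "U \<in> subsets eq"
  then have "U x \<le> ext eq x" unfolding subsets_def by simp
  then show "w \<le> U x \<Longrightarrow> w \<le> ext eq x" by (rule order_trans[rotated])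
qed

lemma subsets_subst: "U \<in> subsets eq \<Longrightarrow> w \<le> U x \<Longrightarrow> w \<le> eq x y \<Longrightarrow> w \<le> U y"
proof -
  assume "U \<in> subsets eq"
  then have "U x \<sqinter> eq x y \<le> U y" unfolding subsets_def by simp
  then show "w \<le> U x \<Longrightarrow> w \<le> eq x y \<Longrightarrow> w \<le> U y" by (rule forces_inf_le)
qed

lemma subsetsI:
  fixes U :: "'s \<Rightarrow> 'h::frame"
  assumes "\<And>x w. w \<le> U x \<Longrightarrow> w \<le> ext eq x"
    and "\<And>x y w. w \<le> U x \<Longrightarrow> w \<le> eq x y \<Longrightarrow> w \<le> U y"
  shows "U \<in> subsets eq"
proof -
  have "U x \<sqinter> eq x y \<le> U y" for x y
    by (rule assms(2)[of _ x]) simp_all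
  then show ?thesis
    unfolding subsets_def using assms(1) by simp
qed

lemma subset_eqD:
  fixes U :: "'s \<Rightarrow> 'h::frame"
  assumes "w \<le> subset_eq U V" "w \<le> U x"
  shows "w \<le> V x"
proof (rule forces_mp)
  show "w \<le> (U x \<^bold>\<longrightarrow> V x)"
    using assms(1) unfolding subset_eq_def by (simp add: le_INF_iff)
qed (rule assms(2))

lemma elem_subset_rels_ext:
  "R \<in> elem_subset_rels eq \<Longrightarrow> U \<in> subsets eq \<Longrightarrow> w \<le> R a U \<Longrightarrow> w \<le> ext eq a"
proof -
  assume "R \<in> elem_subset_rels eq" "U \<in> subsets eq"
  then have "R a U \<le> ext eq a" unfolding elem_subset_rels_def by simp
  then show "w \<le> R a U \<Longrightarrow> w \<le> ext eq a" by (rule order_trans[rotated])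
qed

lemma elem_subset_rels_subst:
  assumes "R \<in> elem_subset_rels eq" "U \<in> subsets eq" "w \<le> R a U" "w \<le> eq a b"
  shows "w \<le> R b U"
proof -
  have "R a U \<sqinter> eq a b \<sqinter> subset_eq U U \<le> R b U"
    using assms(1,2) unfolding elem_subset_rels_def by simp
  moreover have "w \<le> subset_eq U U"
    unfolding subset_eq_def by (intro INF_greatest le_infI forces_imp)
  ultimately show ?thesis
    using le_infI[OF assms(3,4)] by (elim forces_inf_le)
qed


section \<open>Covering relations at a stage\<close>

lemma least_coveringI:
  assumes "\<And>R w. R \<in> elem_subset_rels eq \<Longrightarrow> w \<le> c \<Longrightarrow> w \<le> is_covering eq le R
    \<Longrightarrow> w \<le> P R \<Longrightarrow> w \<le> R a U"
  shows "c \<le> least_covering eq le P a U"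
  unfolding least_covering_def by (intro INF_greatest forces_imp) (simp add: assms)

lemma least_coveringD:
  assumes "c \<le> least_covering eq le P a U" "R \<in> elem_subset_rels eq"
    and "c \<le> is_covering eq le R" "c \<le> P R"
  shows "c \<le> R a U"
proof (rule forces_mp)
  show "c \<le> (is_covering eq le R \<^bold>\<and> P R \<^bold>\<longrightarrow> R a U)"
    using assms(1) unfolding least_covering_def by (rule forces_INFD) (rule assms(2))
qed (use assms in simp)

lemma positively_closedI:
  assumes "\<And>u V w. V \<in> subsets eq \<Longrightarrow> w \<le> c \<Longrightarrow> w \<le> F u \<Longrightarrow> w \<le> cov u V \<Longrightarrow> w \<le> (\<^bold>\<exists>v\<^bold>\<in>V. F v)"
  shows "c \<le> positively_closed eq cov F"
  unfolding positively_closed_def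
proof (intro forces_all INF_greatest forces_imp)
  fix u w V w' assume "w \<le> c" "V \<in> subsets eq" "w' \<le> w" "w' \<le> (F u \<^bold>\<and> cov u V)"
  then show "w' \<le> (\<^bold>\<exists>v\<^bold>\<in>V. F v)"
    using assms[of V w' u] order_trans[of w' w c] by simp
qed

lemma positively_closedD:
  assumes "c \<le> positively_closed eq cov F" "F \<in> subsets eq" "V \<in> subsets eq"
    and "c \<le> F u" "c \<le> cov u V"
  shows "c \<le> (\<^bold>\<exists>v\<^bold>\<in>V. F v)"
proof (rule forces_mp)
  show "c \<le> (F u \<^bold>\<and> cov u V \<^bold>\<longrightarrow> (\<^bold>\<exists>v\<^bold>\<in>V. F v))"
    by (rule forces_INFD[OF forces_allD[OF assms(1)[unfolded positively_closed_def],
            OF subsets_ext[OF assms(2), OF assms(4)]] assms(3)])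
qed (use assms in simp)

lemma covering_subsetI:
  assumes "\<And>a U w. U \<in> subsets eq \<Longrightarrow> w \<le> c \<Longrightarrow> w \<le> ext eq a \<Longrightarrow> w \<le> R a U \<Longrightarrow> w \<le> R' a U"
  shows "c \<le> covering_subset eq R R'"
  unfolding covering_subset_def
proof (intro forces_all INF_greatest forces_imp)
  fix a w U w' assume "w \<le> c" "w \<le> ext eq a" "U \<in> subsets eq" "w' \<le> w" "w' \<le> R a U"
  then show "w' \<le> R' a U"
    using assms[of U w' a] order_trans[of w' w] by simp
qed

lemma covering_subsetD:
  assumes "c \<le> covering_subset eq R R'" "U \<in> subsets eq" "c \<le> ext eq a" "c \<le> R a U"
  shows "c \<le> R' a U"
  by (rule forces_mp[OF forces_INFD[OF forces_allD[OF assms(1)[unfolded covering_subset_def],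
          OF assms(3)] assms(2)] assms(4)])

context
  fixes eq :: "'s \<Rightarrow> 's \<Rightarrow> 'h::frame" and le R and c :: 'h
  assumes R: "R \<in> elem_subset_rels eq" and cov: "c \<le> is_covering eq le R"
begin

lemma covering_Tra:
  assumes "U \<in> subsets eq" "V \<in> subsets eq" "c \<le> R a U"
    and "\<And>u w. w \<le> c \<Longrightarrow> w \<le> U u \<Longrightarrow> w \<le> R u V"
  shows "c \<le> R a V"
proof -
  have "c \<le> (\<^bold>\<forall>a\<^bold>\<in>ext eq. \<Sqinter>U\<in>subsets eq. \<Sqinter>V\<in>subsets eq. R a U \<^bold>\<and> covers R U V \<^bold>\<longrightarrow> R a V)"
    using cov unfolding is_covering_def by simp
  from forces_mp[OF forces_INFD[OF forces_INFD[OF forces_allD[OF this] assms(1)] assms(2)]]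
  show ?thesis
    using elem_subset_rels_ext[OF R, OF assms(1,3)] assms(3) forces_all[of c U "\<lambda>u. R u V", OF assms(4)]
    by (simp add: covers_def)
qed

lemma covering_Loc:
  assumes "U \<in> subsets eq" "V \<in> subsets eq" "c \<le> R a U" "c \<le> R a V"
  shows "c \<le> R a (common_refinement le U V)"
proof -
  have "c \<le> (\<^bold>\<forall>a\<^bold>\<in>ext eq. \<Sqinter>U\<in>subsets eq. \<Sqinter>V\<in>subsets eq.
      R a U \<^bold>\<and> R a V \<^bold>\<longrightarrow> R a (common_refinement le U V))"
    using cov unfolding is_covering_def by simp
  from forces_mp[OF forces_INFD[OF forces_INFD[OF forces_allD[OF this] assms(1)] assms(2)]]
  show ?thesis
    using elem_subset_rels_ext[OF R, OF assms(1,3)] assms(3,4) by simp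
qed

lemma covering_Ext:
  assumes "c \<le> ext eq a" "c \<le> ext eq b" "c \<le> le a b"
  shows "c \<le> R a (\<lambda>x. eq x b)"
proof -
  have "c \<le> (\<^bold>\<forall>a\<^bold>\<in>ext eq. \<^bold>\<forall>b\<^bold>\<in>ext eq. le a b \<^bold>\<longrightarrow> R a (\<lambda>c. eq c b))"
    using cov unfolding is_covering_def by simp
  from forces_mp[OF forces_allD[OF forces_allD[OF this, OF assms(1)], OF assms(2)] assms(3)]
  show ?thesis .
qed

end


section \<open>Positively closed predicates and their sublocales\<close>

text \<open>
  The assumption \<open>eq_le\<close> combines reflexivity and compatibility with equality: together with
  transitivity it implies that \<open>le\<close> respects \<open>eq\<close> in both arguments.
\<close>

locale hpreorder =
  fixes eq :: "'s \<Rightarrow> 's \<Rightarrow> 'h::frame" and le :: "'s \<Rightarrow> 's \<Rightarrow> 'h"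
  assumes hset: "hset eq"
    and le_ext: "le a b \<le> ext eq a \<sqinter> ext eq b"
    and eq_le: "eq a b \<le> le a b"
    and le_trans: "le a b \<sqinter> le b c \<le> le a c"
begin

lemmas eq_sym = hset_sym[OF hset] and eq_trans = hset_trans[OF hset] and eq_ext = hset_ext[OF hset]

lemma le_extD: "w \<le> le a b \<Longrightarrow> w \<le> ext eq a" "w \<le> le a b \<Longrightarrow> w \<le> ext eq b"
  by (rule order_trans[OF order_trans[OF _ le_ext] inf_le1], assumption)
    (rule order_trans[OF order_trans[OF _ le_ext] inf_le2])

lemma forces_eq_le: "w \<le> eq a b \<Longrightarrow> w \<le> le a b"
  using eq_le by (rule order_trans[rotated])

lemma forces_le_trans: "w \<le> le a b \<Longrightarrow> w \<le> le b c \<Longrightarrow> w \<le> le a c"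
  using le_trans by (rule forces_inf_le)

lemma singleton_subset: "(\<lambda>x. eq x b) \<in> subsets eq"
  by (rule subsetsI) (rule eq_ext, assumption, rule eq_trans[OF eq_sym])

lemma restricted_singleton_subset: "(\<lambda>x. eq x b \<^bold>\<and> p) \<in> subsets eq"
proof (rule subsetsI)
  show "w \<le> (eq y b \<^bold>\<and> p)" if "w \<le> (eq x b \<^bold>\<and> p)" "w \<le> eq x y" for x y w
    using that eq_trans[OF eq_sym[OF that(2)], of b] by simp
  show "w \<le> ext eq x" if "w \<le> (eq x b \<^bold>\<and> p)" for x w
    using that eq_ext[of w x b] by simp
qed

lemma common_refinement_subset: "common_refinement le U V \<in> subsets eq"
proof (rule subsetsI)
  fix x w assume w: "w \<le> common_refinement le U V x"
  show "w \<le> ext eq x"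
    using w unfolding common_refinement_def
    by (elim forces_exE) (rule le_extD(1), rule order_trans, assumption, rule inf_le1)
next
  fix x y w assume w: "w \<le> common_refinement le U V x" and xy: "w \<le> eq x y"
  show "w \<le> common_refinement le U V y"
    using w[unfolded common_refinement_def]
  proof (elim forces_exE)
    fix u v w1 w2
    assume "w1 \<le> w" "w1 \<le> U u" "w2 \<le> w1" "w2 \<le> V v" and le: "w2 \<le> (le x u \<^bold>\<and> le x v)"
    then have "w2 \<le> U u" "w2 \<le> w" by simp_all
    then have "w2 \<le> le y x" by (intro forces_eq_le[OF eq_sym] order_trans[OF _ xy])
    then have "w2 \<le> (le y u \<^bold>\<and> le y v)"
      by (intro le_infI; rule forces_le_trans[of _ _ x]) (use le in simp_all)
    with \<open>w2 \<le> U u\<close> \<open>w2 \<le> V v\<close> show "w2 \<le> common_refinement le U V y"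
      unfolding common_refinement_def by (intro forces_ex[of _ _ u] forces_ex[of _ _ v])
  qed
qed

text \<open>
  Positive closure of \<open>F\<close> asks only for a positive element of \<open>V\<close>. Used directly as a definition of
  ``\<open>V\<close> covers \<open>a\<close>'', this would violate (Loc), because positive elements of two covers need have
  no positive common refinement. Requiring the positive element to refine a given positive
  \<open>b \<le> a\<close> makes the condition local: it says that, among the positive elements, those
  lying below an element of \<open>V\<close> are dense below \<open>a\<close>.
\<close>

definition pos_cover :: "('s \<Rightarrow> 'h) \<Rightarrow> 's \<Rightarrow> ('s \<Rightarrow> 'h) \<Rightarrow> 'h"
  where "pos_cover F a V = (ext eq a \<^bold>\<and>
    (\<^bold>\<forall>b\<^bold>\<in>(\<lambda>b. le b a \<^bold>\<and> F b). \<^bold>\<exists>v\<^bold>\<in>V. \<^bold>\<exists>c\<^bold>\<in>F. le c b \<^bold>\<and> le c v))"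

lemma pos_coverI:
  assumes "c \<le> ext eq a"
    and "\<And>b w. w \<le> c \<Longrightarrow> w \<le> le b a \<Longrightarrow> w \<le> F b
      \<Longrightarrow> w \<le> (\<^bold>\<exists>v\<^bold>\<in>V. \<^bold>\<exists>c\<^bold>\<in>F. le c b \<^bold>\<and> le c v)"
  shows "c \<le> pos_cover F a V"
  unfolding pos_cover_def
proof (intro le_infI assms(1) forces_all)
  fix b w assume "w \<le> c" "w \<le> (le b a \<^bold>\<and> F b)"
  then show "w \<le> (\<^bold>\<exists>v\<^bold>\<in>V. \<^bold>\<exists>c\<^bold>\<in>F. le c b \<^bold>\<and> le c v)" by (intro assms(2)) simp_all
qed

lemma pos_coverE:
  assumes "w \<le> pos_cover F a V" "w \<le> le b a" "w \<le> F b"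
    and "\<And>v c w'. w' \<le> w \<Longrightarrow> w' \<le> V v \<Longrightarrow> w' \<le> F c \<Longrightarrow> w' \<le> le c b \<Longrightarrow> w' \<le> le c v
      \<Longrightarrow> w' \<le> q"
  shows "w \<le> q"
proof -
  have "w \<le> (\<^bold>\<forall>b\<^bold>\<in>(\<lambda>b. le b a \<^bold>\<and> F b). \<^bold>\<exists>v\<^bold>\<in>V. \<^bold>\<exists>c\<^bold>\<in>F. le c b \<^bold>\<and> le c v)"
    using assms(1) unfolding pos_cover_def by simp
  from forces_allD[OF this, of b] have "w \<le> (\<^bold>\<exists>v\<^bold>\<in>V. \<^bold>\<exists>c\<^bold>\<in>F. le c b \<^bold>\<and> le c v)"
    using assms(2,3) by simp
  then show ?thesis
  proof (elim forces_exE)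
    fix v c w1 w2 assume "w1 \<le> w" "w1 \<le> V v" "w2 \<le> w1" "w2 \<le> F c" "w2 \<le> (le c b \<^bold>\<and> le c v)"
    then show "w2 \<le> q"
      using assms(4)[of w2 v c] order_trans[of w2 w1] by simp
  qed
qed

lemma forces_refinement:
  "w \<le> V v \<Longrightarrow> w \<le> F c \<Longrightarrow> w \<le> le c b \<Longrightarrow> w \<le> le c v
    \<Longrightarrow> w \<le> (\<^bold>\<exists>v\<^bold>\<in>V. \<^bold>\<exists>c\<^bold>\<in>F. le c b \<^bold>\<and> le c v)"
  by (intro forces_ex[of _ _ v] forces_ex[of _ _ c]) simp_all

lemma pos_cover_elem_subset_rels: "pos_cover F \<in> elem_subset_rels eq"
proof -
  have "pos_cover F a U \<sqinter> eq a b \<sqinter> subset_eq U V \<le> pos_cover F b V" (is "?c \<le> _") for a b U V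
  proof (rule pos_coverI)
    have ab: "?c \<le> eq a b" by (simp add: le_infI1)
    then show "?c \<le> ext eq b" by (intro eq_ext[OF eq_sym])
    fix b' w assume w: "w \<le> ?c" "w \<le> le b' b" "w \<le> F b'"
    then have U: "w \<le> pos_cover F a U" and eq: "w \<le> eq a b" and sub: "w \<le> subset_eq U V"
      by simp_all
    have "w \<le> le b' a"
      using w(2) forces_eq_le[OF eq_sym[OF eq]] by (rule forces_le_trans)
    from U this w(3) show "w \<le> (\<^bold>\<exists>v\<^bold>\<in>V. \<^bold>\<exists>c\<^bold>\<in>F. le c b' \<^bold>\<and> le c v)"
    proof (rule pos_coverE)
      fix v c w' assume w': "w' \<le> w" "w' \<le> U v" "w' \<le> F c" "w' \<le> le c b'" "w' \<le> le c v"
      show "w' \<le> (\<^bold>\<exists>v\<^bold>\<in>V. \<^bold>\<exists>c\<^bold>\<in>F. le c b' \<^bold>\<and> le c v)"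
        using subset_eqD[OF order_trans[OF w'(1) sub], OF w'(2)] w'(3-5) by (rule forces_refinement)
    qed
  qed
  moreover have "pos_cover F a U \<le> ext eq a" for a U
    unfolding pos_cover_def by simp
  ultimately show ?thesis
    unfolding elem_subset_rels_def by simp
qed

text \<open>
  All four axioms hold for an arbitrary predicate \<open>F\<close>. For (Tra) and (Loc) the refinement supplied
  by the first cover is refined once more by the second one.
\<close>

lemma pos_cover_is_covering: "c \<le> is_covering eq le (pos_cover F)"
  unfolding is_covering_def
proof (intro le_infI forces_all INF_greatest forces_imp)
  fix a U w w' assume a: "w \<le> ext eq a" and w: "w' \<le> w" "w' \<le> U a"
  show "w' \<le> pos_cover F a U"
  proof (rule pos_coverI)
    fix b v assume v: "v \<le> w'" "v \<le> le b a" "v \<le> F b"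
    show "v \<le> (\<^bold>\<exists>v\<^bold>\<in>U. \<^bold>\<exists>c\<^bold>\<in>F. le c b \<^bold>\<and> le c v)"
      using order_trans[OF v(1) w(2)] v(3) forces_eq_le[OF le_extD(1)[OF v(2)]] v(2)
      by (rule forces_refinement)
  qed (use a w in simp)
next
  fix a U V w w'
  assume a: "w \<le> ext eq a" and w: "w' \<le> w" "w' \<le> (pos_cover F a U \<^bold>\<and> covers (pos_cover F) U V)"
  show "w' \<le> pos_cover F a V"
  proof (rule pos_coverI)
    fix b v assume v: "v \<le> w'" "v \<le> le b a" "v \<le> F b"
    note up = order_trans[OF v(1)]
    have U: "v \<le> pos_cover F a U" using up[OF w(2)] by simp
    show "v \<le> (\<^bold>\<exists>v\<^bold>\<in>V. \<^bold>\<exists>c\<^bold>\<in>F. le c b \<^bold>\<and> le c v)"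
    proof (rule pos_coverE[OF U, OF v(2,3)])
      fix u c v' assume v': "v' \<le> v" "v' \<le> U u" "v' \<le> F c" "v' \<le> le c b" "v' \<le> le c u"
      have "v' \<le> covers (pos_cover F) U V" using order_trans[OF v'(1) up[OF w(2)]] by simp
      then have V: "v' \<le> pos_cover F u V" unfolding covers_def by (rule forces_allD) fact
      show "v' \<le> (\<^bold>\<exists>v\<^bold>\<in>V. \<^bold>\<exists>c\<^bold>\<in>F. le c b \<^bold>\<and> le c v)"
      proof (rule pos_coverE[OF V, OF v'(5,3)])
        fix y e x assume x: "x \<le> v'" "x \<le> V y" "x \<le> F e" "x \<le> le e c" "x \<le> le e y"
        show "x \<le> (\<^bold>\<exists>v\<^bold>\<in>V. \<^bold>\<exists>c\<^bold>\<in>F. le c b \<^bold>\<and> le c v)"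
          using x(2,3) forces_le_trans[OF x(4) order_trans[OF x(1) v'(4)]] x(5)
          by (rule forces_refinement)
      qed
    qed
  qed (use a w in simp)
next
  fix a U V w w'
  assume a: "w \<le> ext eq a" and w: "w' \<le> w" "w' \<le> (pos_cover F a U \<^bold>\<and> pos_cover F a V)"
  show "w' \<le> pos_cover F a (common_refinement le U V)"
  proof (rule pos_coverI)
    fix b v assume v: "v \<le> w'" "v \<le> le b a" "v \<le> F b"
    note up = order_trans[OF v(1) w(2)]
    then have U: "v \<le> pos_cover F a U" by simp
    show "v \<le> (\<^bold>\<exists>v\<^bold>\<in>common_refinement le U V. \<^bold>\<exists>c\<^bold>\<in>F. le c b \<^bold>\<and> le c v)"
    proof (rule pos_coverE[OF U, OF v(2,3)])
      fix u c v' assume v': "v' \<le> v" "v' \<le> U u" "v' \<le> F c" "v' \<le> le c b" "v' \<le> le c u"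
      have V: "v' \<le> pos_cover F a V" "v' \<le> le c a"
        using order_trans[OF v'(1) up] forces_le_trans[OF v'(4) order_trans[OF v'(1) v(2)]]
        by simp_all
      show "v' \<le> (\<^bold>\<exists>v\<^bold>\<in>common_refinement le U V. \<^bold>\<exists>c\<^bold>\<in>F. le c b \<^bold>\<and> le c v)"
      proof (rule pos_coverE[OF V(1), OF V(2) v'(3)])
        fix y e x assume x: "x \<le> v'" "x \<le> V y" "x \<le> F e" "x \<le> le e c" "x \<le> le e y"
        note up = order_trans[OF x(1)]
        have "x \<le> common_refinement le U V e"
          unfolding common_refinement_def
          using up[OF v'(2)] x(2,5) forces_le_trans[OF x(4) up[OF v'(5)]]
          by (intro forces_ex[of _ _ u] forces_ex[of _ _ y]) simp_all
        then show "x \<le> (\<^bold>\<exists>v\<^bold>\<in>common_refinement le U V. \<^bold>\<exists>c\<^bold>\<in>F. le c b \<^bold>\<and> le c v)"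
          using x(3) forces_le_trans[OF x(4) up[OF v'(4)]] forces_eq_le[OF le_extD(1)[OF x(4)]]
          by (rule forces_refinement)
      qed
    qed
  qed (use a w in simp)
next
  fix a b w w' v
  assume a: "w \<le> ext eq a" and w: "w' \<le> w" "w' \<le> ext eq b" and v: "v \<le> w'" "v \<le> le a b"
  show "v \<le> pos_cover F a (\<lambda>c. eq c b)"
  proof (rule pos_coverI)
    fix b' x assume x: "x \<le> v" "x \<le> le b' a" "x \<le> F b'"
    note up = order_trans[OF x(1)]
    show "x \<le> (\<^bold>\<exists>v\<^bold>\<in>(\<lambda>c. eq c b). \<^bold>\<exists>c\<^bold>\<in>F. le c b' \<^bold>\<and> le c v)"
    proof (rule forces_refinement[of _ _ b _ b'])
      show "x \<le> eq b b" using up[OF v(2)] by (rule le_extD)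
      show "x \<le> le b' b'" by (rule forces_eq_le) (rule le_extD(1)[OF x(2)])
      show "x \<le> le b' b" using x(2) up[OF v(2)] by (rule forces_le_trans)
    qed (rule x(3))
  qed (rule le_extD(1)[OF v(2)])
qed

text \<open>
  A least covering relation is contained in every covering relation with property \<open>P\<close>, in
  particular in \<open>pos_cover F\<close>. Taking \<open>b = a\<close> there gives a positive element below some
  \<open>v\<close> in \<open>V\<close>, and upward closure moves positivity to \<open>v\<close>.
\<close>

lemma positively_closed_least_coveringI:
  assumes F: "F \<in> subsets eq"
    and up: "\<And>a b w. w \<le> c \<Longrightarrow> w \<le> F a \<Longrightarrow> w \<le> le a b \<Longrightarrow> w \<le> F b"
    and P: "c \<le> P (pos_cover F)"
  shows "c \<le> positively_closed eq (least_covering eq le P) F"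
proof (rule positively_closedI)
  fix u V w assume w: "w \<le> c" "w \<le> F u" "w \<le> least_covering eq le P u V"
  have V: "w \<le> pos_cover F u V"
    by (rule least_coveringD[OF w(3), OF pos_cover_elem_subset_rels pos_cover_is_covering])
      (rule order_trans[OF w(1) P])
  have "w \<le> le u u" by (rule forces_eq_le) (rule subsets_ext[OF F, OF w(2)])
  show "w \<le> (\<^bold>\<exists>v\<^bold>\<in>V. F v)"
  proof (rule pos_coverE[OF V, OF \<open>w \<le> le u u\<close> w(2)])
    fix v c' w' assume w': "w' \<le> w" "w' \<le> V v" "w' \<le> F c'" "w' \<le> le c' v"
    have "w' \<le> F v" using order_trans[OF w'(1) w(1)] w'(3,4) by (rule up)
    with w'(2) show "w' \<le> (\<^bold>\<exists>v\<^bold>\<in>V. F v)" by (rule forces_ex)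
  qed
qed

text \<open>
  This is the localisation needed to pass from a cover of \<open>a\<close> to the refinements demanded by
  \<open>pos_cover\<close>. It follows from (Ext), (Tra) and (Loc), applied to each covering relation in the
  intersection.
\<close>

lemma least_covering_refinement:
  assumes V: "V \<in> subsets eq" and ba: "c \<le> le b a" and aV: "c \<le> least_covering eq le P a V"
  shows "c \<le> least_covering eq le P b (common_refinement le (\<lambda>x. eq x b) V)"
proof (rule least_coveringI)
  fix R w assume R: "R \<in> elem_subset_rels eq" and w: "w \<le> c"
    and cov: "w \<le> is_covering eq le R" and P: "w \<le> P R"
  note up = order_trans[OF w]
  have b: "w \<le> ext eq b" and a: "w \<le> ext eq a" using up[OF ba] by (rule le_extD)+
  have "w \<le> R a V" by (rule least_coveringD[OF up[OF aV], OF R cov P])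
  have "w \<le> R b V"
  proof (rule covering_Tra[OF R cov, OF singleton_subset V])
    show "w \<le> R b (\<lambda>x. eq x a)" using b a up[OF ba] by (rule covering_Ext[OF R cov])
    show "v \<le> R u V" if "v \<le> w" "v \<le> eq u a" for u v
      by (rule elem_subset_rels_subst[OF R V, OF order_trans[OF that(1) \<open>w \<le> R a V\<close>],
            OF eq_sym[OF that(2)]])
  qed
  have "w \<le> R b (\<lambda>x. eq x b)"
    using b b forces_eq_le[OF b] by (rule covering_Ext[OF R cov])
  from covering_Loc[OF R cov, OF singleton_subset V this \<open>w \<le> R b V\<close>]
  show "w \<le> R b (common_refinement le (\<lambda>x. eq x b) V)" .
qed

lemma positively_closed_upward:
  assumes F: "F \<in> subsets eq"
    and pc: "c \<le> positively_closed eq (least_covering eq le P) F"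
    and "c \<le> F a" "c \<le> le a b"
  shows "c \<le> F b"
proof -
  have "c \<le> least_covering eq le P a (\<lambda>x. eq x b)"
  proof (rule least_coveringI)
    fix R w assume R: "R \<in> elem_subset_rels eq" and w: "w \<le> c" and cov: "w \<le> is_covering eq le R"
    have "w \<le> le a b" using w assms(4) by simp
    from covering_Ext[OF R cov, OF le_extD[OF this] this] show "w \<le> R a (\<lambda>x. eq x b)" .
  qed
  from positively_closedD[OF pc, OF F singleton_subset assms(3) this]
  show ?thesis by (rule forces_exE) (rule subsets_subst[OF F])
qed

text \<open>
  The sublocale is again a least covering relation, so it is enough that \<open>pos_cover F\<close> contains
  the original cover and satisfies the additional axiom. The former holds because \<open>F\<close>
  is positively closed and covers of \<open>a\<close> localise to every \<open>b \<le> a\<close>; the latter because \<open>F\<close> is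
  upward closed.
\<close>

lemma positively_closed_in_sublocale:
  assumes F: "F \<in> subsets eq"
    and pc: "c \<le> positively_closed eq (least_covering eq le P) F"
  shows "c \<le> positively_closed eq (poscl_sublocale eq le (least_covering eq le P) F) F"
  unfolding poscl_sublocale_def
proof (rule positively_closed_least_coveringI[OF F])
  show up: "w \<le> F b" if "w \<le> c" "w \<le> F a" "w \<le> le a b" for w a b
    using positively_closed_upward[OF F order_trans[OF that(1) pc] that(2,3)] .
  show "c \<le> (covering_subset eq (least_covering eq le P) (pos_cover F) \<^bold>\<and>
      (\<^bold>\<forall>u\<^bold>\<in>ext eq. pos_cover F u (\<lambda>u'. eq u' u \<^bold>\<and> F u)))"
  proof (intro le_infI covering_subsetI forces_all pos_coverI)
    fix a V w b w' assume V: "V \<in> subsets eq" and w: "w \<le> c" "w \<le> least_covering eq le P a V"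
      and w': "w' \<le> w" "w' \<le> le b a" "w' \<le> F b"
    have "w' \<le> (\<^bold>\<exists>v\<^bold>\<in>common_refinement le (\<lambda>x. eq x b) V. F v)"
      using least_covering_refinement[OF V w'(2) order_trans[OF w'(1) w(2)]]
      by (rule positively_closedD[OF order_trans[OF order_trans[OF w'(1) w(1)] pc],
            OF F common_refinement_subset w'(3)])
    then show "w' \<le> (\<^bold>\<exists>v\<^bold>\<in>V. \<^bold>\<exists>c\<^bold>\<in>F. le c b \<^bold>\<and> le c v)"
      unfolding common_refinement_def
    proof (elim forces_exE)
      fix e x u x1 v x2
      assume x: "x \<le> F e" "x1 \<le> x" "x2 \<le> x1" "x2 \<le> V v"
        "x1 \<le> eq u b" "x2 \<le> (le e u \<^bold>\<and> le e v)"
      have e: "x2 \<le> F e" "x2 \<le> le e u" "x2 \<le> le e v" "x2 \<le> le u b"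
        using x order_trans[OF x(3) forces_eq_le[OF x(5)]] by simp_all
      show "x2 \<le> (\<^bold>\<exists>v\<^bold>\<in>V. \<^bold>\<exists>c\<^bold>\<in>F. le c b \<^bold>\<and> le c v)"
        using x(4) e(1) forces_le_trans[OF e(2,4)] e(3) by (rule forces_refinement)
    qed
  next
    fix u w b w' assume w: "w \<le> c" "w' \<le> w" "w' \<le> le b u" "w' \<le> F b"
    have "w' \<le> F u" using order_trans[OF w(2,1)] w(4,3) by (rule up)
    then have "w' \<le> (eq u u \<^bold>\<and> F u)" using le_extD(2)[OF w(3)] by simp
    then show "w' \<le> (\<^bold>\<exists>v\<^bold>\<in>(\<lambda>u'. eq u' u \<^bold>\<and> F u). \<^bold>\<exists>c\<^bold>\<in>F. le c b \<^bold>\<and> le c v)"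
      using w(4) forces_eq_le[OF le_extD(1)[OF w(3)]] w(3) by (rule forces_refinement)
  qed
qed

text \<open>
  In the sublocale of \<open>F\<close> the family \<open>{u' : u' = u and F u}\<close> covers \<open>u\<close>, hence it does so in the
  sublocale of \<open>G\<close>. As \<open>G\<close> is positively closed there, \<open>G u\<close> makes the family inhabited.
\<close>

lemma sublocale_subset_imp_predicate_subset:
  assumes F: "F \<in> subsets eq" and G: "G \<in> subsets eq"
    and cov: "cov = least_covering eq le P"
    and pc: "c \<le> positively_closed eq cov G"
    and sub: "c \<le> covering_subset eq (poscl_sublocale eq le cov F) (poscl_sublocale eq le cov G)"
    and u: "c \<le> G u"
  shows "c \<le> F u"
proof -
  have ext: "c \<le> ext eq u" by (rule subsets_ext[OF G, OF u])
  have "c \<le> poscl_sublocale eq le cov F u (\<lambda>u'. eq u' u \<^bold>\<and> F u)"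
    unfolding poscl_sublocale_def
  proof (rule least_coveringI)
    fix R w assume w: "w \<le> c"
      and "w \<le> (covering_subset eq cov R \<^bold>\<and> (\<^bold>\<forall>u\<^bold>\<in>ext eq. R u (\<lambda>u'. eq u' u \<^bold>\<and> F u)))"
    then have "w \<le> (\<^bold>\<forall>u\<^bold>\<in>ext eq. R u (\<lambda>u'. eq u' u \<^bold>\<and> F u))" by simp
    from forces_allD[OF this, OF order_trans[OF w ext]] show "w \<le> R u (\<lambda>u'. eq u' u \<^bold>\<and> F u)" .
  qed
  from covering_subsetD[OF sub, OF restricted_singleton_subset ext this]
  have G_cov: "c \<le> poscl_sublocale eq le (least_covering eq le P) G u (\<lambda>u'. eq u' u \<^bold>\<and> F u)"
    unfolding cov .
  have "c \<le> (\<^bold>\<exists>v\<^bold>\<in>(\<lambda>u'. eq u' u \<^bold>\<and> F u). G v)"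
    by (rule positively_closedD[OF positively_closed_in_sublocale[OF G pc[unfolded cov]],
          OF G restricted_singleton_subset u G_cov])
  then show ?thesis by (rule forces_exE) simp
qed

end



section \<open>Metric spaces and their formal balls\<close>

locale hmetric =
  fixes eq :: "'x \<Rightarrow> 'x \<Rightarrow> 'h::frame" and d :: "'x \<Rightarrow> 'x \<Rightarrow> rat \<Rightarrow> 'h"
  assumes hset: "hset eq" and dist: "distance_rel eq d" and metric: "\<Turnstile> is_metric eq d"
begin

lemmas eq_sym = hset_sym[OF hset] and eq_trans = hset_trans[OF hset] and eq_ext = hset_ext[OF hset]

lemma d_ext:
  assumes "w \<le> d x y r"
  shows "w \<le> ext eq x" "w \<le> ext eq y"
proof -
  have "d x y r \<le> ext eq x \<sqinter> ext eq y"
    using dist[unfolded distance_rel_def, THEN conjunct1] by blast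
  with assms have "w \<le> ext eq x \<sqinter> ext eq y" by (rule order_trans)
  then show "w \<le> ext eq x" "w \<le> ext eq y" by simp_all
qed

lemma d_subst:
  assumes "w \<le> d x y r" "w \<le> eq x x'" "w \<le> eq y y'"
  shows "w \<le> d x' y' r"
proof -
  have "d x y r \<sqinter> eq x x' \<sqinter> eq y y' \<le> d x' y' r"
    using dist[unfolded distance_rel_def, THEN conjunct2, THEN conjunct1] by blast
  from this le_infI[OF assms(1,2)] assms(3) show ?thesis by (rule forces_inf_le)
qed

lemma d_nonpos: "r \<le> 0 \<Longrightarrow> d x y r = \<bottom>"
  using dist[unfolded distance_rel_def, THEN conjunct2, THEN conjunct2] by blast

lemma
  fixes w :: 'h
  shows metric_open: "w \<le> (\<^bold>\<forall>x\<^bold>\<in>ext eq. \<^bold>\<forall>y\<^bold>\<in>ext eq. \<Sqinter>r\<in>{0<..}. d x y r \<^bold>\<longrightarrow> (\<Squnion>s\<in>{0<..<r}. d x y s))"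
    and metric_eq: "w \<le> (\<^bold>\<forall>x\<^bold>\<in>ext eq. \<^bold>\<forall>y\<^bold>\<in>ext eq. (\<Sqinter>r\<in>{0<..}. d x y r) \<^bold>\<longleftrightarrow> eq x y)"
    and metric_sym: "w \<le> (\<^bold>\<forall>x\<^bold>\<in>ext eq. \<^bold>\<forall>y\<^bold>\<in>ext eq. \<Sqinter>r\<in>{0<..}. d x y r \<^bold>\<longleftrightarrow> d y x r)"
    and metric_triangle: "w \<le> (\<^bold>\<forall>x\<^bold>\<in>ext eq. \<^bold>\<forall>y\<^bold>\<in>ext eq. \<^bold>\<forall>z\<^bold>\<in>ext eq. \<Sqinter>r\<in>{0<..}. \<Sqinter>s\<in>{0<..}.
        d x y r \<^bold>\<and> d y z s \<^bold>\<longrightarrow> d x z (r + s))"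
proof -
  have "w \<le> is_metric eq d" using metric unfolding valid_def by (simp only: top_greatest)
  note w = this[unfolded is_metric_def le_inf_iff]
  show "w \<le> (\<^bold>\<forall>x\<^bold>\<in>ext eq. \<^bold>\<forall>y\<^bold>\<in>ext eq. \<Sqinter>r\<in>{0<..}. d x y r \<^bold>\<longrightarrow> (\<Squnion>s\<in>{0<..<r}. d x y s))"
    using w[THEN conjunct2, THEN conjunct1] .
  show "w \<le> (\<^bold>\<forall>x\<^bold>\<in>ext eq. \<^bold>\<forall>y\<^bold>\<in>ext eq. (\<Sqinter>r\<in>{0<..}. d x y r) \<^bold>\<longleftrightarrow> eq x y)"
    using w[THEN conjunct2, THEN conjunct2, THEN conjunct1] .
  show "w \<le> (\<^bold>\<forall>x\<^bold>\<in>ext eq. \<^bold>\<forall>y\<^bold>\<in>ext eq. \<Sqinter>r\<in>{0<..}. d x y r \<^bold>\<longleftrightarrow> d y x r)"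
    using w[THEN conjunct2, THEN conjunct2, THEN conjunct2, THEN conjunct1] .
  show "w \<le> (\<^bold>\<forall>x\<^bold>\<in>ext eq. \<^bold>\<forall>y\<^bold>\<in>ext eq. \<^bold>\<forall>z\<^bold>\<in>ext eq. \<Sqinter>r\<in>{0<..}. \<Sqinter>s\<in>{0<..}.
        d x y r \<^bold>\<and> d y z s \<^bold>\<longrightarrow> d x z (r + s))"
    using w[THEN conjunct2, THEN conjunct2, THEN conjunct2, THEN conjunct2] .
qed

lemma d_openE:
  assumes w: "w \<le> d x y r"
    and q: "\<And>s w'. 0 < s \<Longrightarrow> s < r \<Longrightarrow> w' \<le> w \<Longrightarrow> w' \<le> d x y s \<Longrightarrow> w' \<le> q"
  shows "w \<le> q"
proof (cases "0 < r")
  case True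
  then have r: "r \<in> {0<..}" by simp
  have "w \<le> (\<Squnion>s\<in>{0<..<r}. d x y s)"
    by (rule forces_mp[OF forces_INFD[OF
          forces_allD[OF forces_allD[OF metric_open, OF d_ext(1)[OF w]], OF d_ext(2)[OF w]] r] w])
  then show ?thesis by (rule forces_SUPE) (auto intro: q)
next
  case False
  with w have "w = \<bottom>" by (simp add: d_nonpos bot_unique)
  then show ?thesis by simp
qed

lemma d_eq:
  assumes "w \<le> eq x y" "0 < r"
  shows "w \<le> d x y r"
proof -
  have "w \<le> ((\<Sqinter>r\<in>{0<..}. d x y r) \<^bold>\<longleftrightarrow> eq x y)"
    by (rule forces_allD[OF forces_allD[OF metric_eq, OF eq_ext[OF assms(1)]],
          OF eq_ext[OF eq_sym[OF assms(1)]]])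
  then have "w \<le> (eq x y \<^bold>\<longrightarrow> (\<Sqinter>r\<in>{0<..}. d x y r))" by simp
  from forces_INFD[OF forces_mp[OF this assms(1)]] assms(2) show ?thesis by simp
qed

lemma d_sym:
  assumes w: "w \<le> d x y r"
  shows "w \<le> d y x r"
proof (cases "0 < r")
  case True
  then have r: "r \<in> {0<..}" by simp
  have "w \<le> (d x y r \<^bold>\<longleftrightarrow> d y x r)"
    by (rule forces_INFD[OF forces_allD[OF forces_allD[OF metric_sym, OF d_ext(1)[OF w]],
            OF d_ext(2)[OF w]] r])
  then have "w \<le> (d x y r \<^bold>\<longrightarrow> d y x r)" by simp
  from forces_mp[OF this w] show ?thesis .
next
  case False
  with w show ?thesis by (simp add: d_nonpos)
qed

lemma d_triangle:
  assumes xy: "w \<le> d x y r" and yz: "w \<le> d y z s"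
  shows "w \<le> d x z (r + s)"
proof (cases "0 < r \<and> 0 < s")
  case True
  then have r: "r \<in> {0<..}" and s: "s \<in> {0<..}" by simp_all
  have "w \<le> (d x y r \<^bold>\<and> d y z s \<^bold>\<longrightarrow> d x z (r + s))"
    by (rule forces_INFD[OF forces_INFD[OF forces_allD[OF forces_allD[OF forces_allD[OF metric_triangle,
                OF d_ext(1)[OF xy]], OF d_ext(1)[OF yz]], OF d_ext(2)[OF yz]] r] s])
  then show ?thesis by (rule forces_mp) (use xy yz in simp)
next
  case False
  with assms have "w = \<bottom>" by (auto simp: d_nonpos bot_unique not_less)
  then show ?thesis by simp
qed

lemma d_mono:
  assumes "w \<le> d x y r" "r \<le> s"
  shows "w \<le> d x y s"
proof (cases "r = s")
  case False
  with assms(2) have "w \<le> d y y (s - r)" by (intro d_eq d_ext(2)[OF assms(1)]) simp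
  from d_triangle[OF assms(1) this] show ?thesis by simp
qed (use assms in simp)

lemma ball_leI:
  assumes "0 < r" "0 < s" "\<And>t. s - r < t \<Longrightarrow> w \<le> d x y t"
  shows "w \<le> ball_le d (x, r) (y, s)"
  using assms by (simp add: le_INF_iff)

lemma ball_leD:
  assumes "w \<le> ball_le d (x, r) (y, s)" "s - r < t"
  shows "w \<le> d x y t"
proof (cases "0 < r \<and> 0 < s")
  case True
  then show ?thesis using assms by (simp add: le_INF_iff)
next
  case False
  then have "ball_le d (x, r) (y, s) = \<bottom>" by auto
  with assms(1) have "w = \<bottom>" by (simp add: bot_unique)
  then show ?thesis by simp
qed

text \<open>
  Pairs with nonpositive radius have extent \<open>\<bottom>\<close>. The order of the rationals is decidable, so the
  radii may be compared outside the internal logic; at the stage \<open>\<bottom>\<close> every formula holds.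
\<close>

lemma ball_le_pos:
  assumes "w \<le> ball_le d (x, r) (y, s)"
  shows "w = \<bottom> \<or> 0 < r \<and> 0 < s"
  using assms by (auto simp: bot_unique split: if_splits)

lemma ball_hpreorder: "hpreorder (ball_eq eq) (ball_le d)"
proof
  have "ball_eq eq a b \<le> ball_eq eq b a" for a b
    by (cases a; cases b) (auto intro: eq_sym[OF order_refl])
  moreover have "ball_eq eq a b \<sqinter> ball_eq eq b c \<le> ball_eq eq a c" for a b c
    by (cases a; cases b; cases c) (auto intro: eq_trans[OF inf_le1 inf_le2])
  ultimately show "hset (ball_eq eq)" unfolding hset_def by blast
next
  fix a b :: "'x ball"
  obtain x r y s where [simp]: "a = (x, r)" "b = (y, s)" by fastforce
  show "ball_le d a b \<le> ext (ball_eq eq) a \<sqinter> ext (ball_eq eq) b" (is "?w \<le> _")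
  proof (cases "0 < r \<and> 0 < s")
    case True
    have "?w \<le> d x y (s - r + 1)" by (rule ball_leD[of _ x r y s]) simp_all
    with True show ?thesis by (simp add: d_ext del: ball_le.simps)
  qed auto
  show "ball_eq eq a b \<le> ball_le d a b"
    by (auto intro!: INF_greatest d_eq)
next
  fix a b c :: "'x ball"
  obtain x r y s z q where [simp]: "a = (x, r)" "b = (y, s)" "c = (z, q)" by (metis surj_pair)
  let ?w = "ball_le d a b \<sqinter> ball_le d b c"
  have ab: "?w \<le> ball_le d (x, r) (y, s)" and bc: "?w \<le> ball_le d (y, s) (z, q)"
    by (simp_all del: ball_le.simps)
  show "?w \<le> ball_le d a c"
  proof (cases "?w = \<bottom>")
    case False
    with ball_le_pos[OF ab] ball_le_pos[OF bc] have "0 < r" "0 < q" by blast+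
    moreover have "?w \<le> d x z t" if t: "q - r < t" for t
    proof -
      \<comment> \<open>The surplus of \<open>t\<close> over \<open>q - r\<close> is shared equally between the two steps.\<close>
      define e where "e = (t - (q - r)) / 2"
      have "0 < e" "t = (s - r + e) + (q - s + e)" using t by (simp_all add: e_def field_simps)
      then show ?thesis
        using d_triangle[OF ball_leD[OF ab, of "s - r + e"] ball_leD[OF bc, of "q - s + e"]] by simp
    qed
    ultimately show ?thesis by (simp only: \<open>a = _\<close> \<open>c = _\<close>) (rule ball_leI)
  next
    case True
    then show ?thesis by simp
  qed
qed

sublocale ball: hpreorder "ball_eq eq" "ball_le d"
  by (rule ball_hpreorder)


section \<open>Locatedness of a subset and of its sublocale\<close>

context
  fixes Y :: "'x \<Rightarrow> 'h"
  assumes Y: "Y \<in> subsets eq"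
begin

lemma PosI:
  assumes "w \<le> Y y" "w \<le> d x y r"
  shows "w \<le> Pos eq d Y (x, r)"
proof (cases "0 < r")
  case True
  then show ?thesis
    unfolding Pos_def using d_ext(1)[OF assms(2)] assms by (auto intro: forces_ex)
next
  case False
  with assms(2) have "w = \<bottom>" by (simp add: d_nonpos bot_unique)
  then show ?thesis by simp
qed

lemma PosE:
  assumes "w \<le> Pos eq d Y (x, r)"
    and "\<And>y w'. w' \<le> w \<Longrightarrow> w' \<le> Y y \<Longrightarrow> w' \<le> d x y r \<Longrightarrow> w' \<le> q"
  shows "w \<le> q"
proof -
  have "w \<le> (\<^bold>\<exists>y\<^bold>\<in>Y. d x y r)" using assms(1) unfolding Pos_def by simp
  then show ?thesis by (rule forces_exE) (rule assms(2))
qed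

lemma Pos_subset: "Pos eq d Y \<in> subsets (ball_eq eq)"
proof (rule subsetsI)
  show "w \<le> ext (ball_eq eq) a" if "w \<le> Pos eq d Y a" for a w
    using that unfolding Pos_def by simp
next
  fix a b w assume a: "w \<le> Pos eq d Y a" and ab: "w \<le> ball_eq eq a b"
  obtain x r y s where [simp]: "a = (x, r)" "b = (y, s)" by fastforce
  show "w \<le> Pos eq d Y b"
  proof (cases "w = \<bottom>")
    case False
    with ab have "r = s" "w \<le> eq x y" by (auto simp: bot_unique split: if_splits)
    from a have "w \<le> Pos eq d Y (x, r)" by simp
    then show ?thesis
    proof (rule PosE)
      fix z w' assume w': "w' \<le> w" "w' \<le> Y z" "w' \<le> d x z r"
      have "w' \<le> d y z s"
        using d_subst[OF w'(3) order_trans[OF w'(1) \<open>w \<le> eq x y\<close>] d_ext(2)[OF w'(3)]] \<open>r = s\<close>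
        by simp
      then show "w' \<le> Pos eq d Y b" using PosI[OF w'(2)] by simp
    qed
  qed simp
qed

text \<open>
  Openness of the distance leaves a margin \<open>e\<close> between a point of \<open>Y\<close> and the boundary of a ball
  containing it.
\<close>

lemma Pos_insideE:
  assumes "w \<le> Pos eq d Y (x, r)"
    and "\<And>y e w'. w' \<le> w \<Longrightarrow> w' \<le> Y y \<Longrightarrow> 0 < e \<Longrightarrow> w' \<le> d x y (r - e) \<Longrightarrow> w' \<le> q"
  shows "w \<le> q"
  using assms(1)
proof (rule PosE)
  fix y w' assume w': "w' \<le> w" "w' \<le> Y y" "w' \<le> d x y r"
  from w'(3) show "w' \<le> q"
  proof (rule d_openE)
    fix s w'' assume "s < r" "w'' \<le> w'" "w'' \<le> d x y s"
    with w' show "w'' \<le> q" by (intro assms(2)[of w'' y "r - s"]) simp_all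
  qed
qed

lemma Pos_upward:
  assumes a: "w \<le> Pos eq d Y a" and ab: "w \<le> ball_le d a b"
  shows "w \<le> Pos eq d Y b"
proof -
  obtain x r z s where [simp]: "a = (x, r)" "b = (z, s)" by fastforce
  from a have "w \<le> Pos eq d Y (x, r)" by simp
  then show ?thesis
  proof (rule Pos_insideE)
    fix y e w' assume w': "w' \<le> w" "w' \<le> Y y" "0 < e" "w' \<le> d x y (r - e)"
    have "w' \<le> ball_le d (x, r) (z, s)" using order_trans[OF w'(1) ab] by simp
    then have "w' \<le> d x z (s - r + e)" by (rule ball_leD) (use w'(3) in simp)
    from d_triangle[OF d_sym[OF this] w'(4)] have "w' \<le> d z y s" by simp
    from PosI[OF w'(2) this] show "w' \<le> Pos eq d Y b" by simp
  qed
qed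

text \<open>
  Half of the margin around \<open>y\<close> is kept for the radius of the small balls; the other half absorbs
  the error in \<open>ball_le\<close>, which bounds the distance of the centres only by every \<open>t > s - r\<close>.
  All sufficiently small radii are provided, because (M2) prescribes an upper bound for them.
\<close>

lemma Pos_small_ballE:
  assumes a: "w \<le> Pos eq d Y a" and ab: "w \<le> ball_le d a b"
    and q: "\<And>y e w'. w' \<le> w \<Longrightarrow> 0 < e \<Longrightarrow> w' \<le> ext eq y
      \<Longrightarrow> (\<And>e'. 0 < e' \<Longrightarrow> e' \<le> e \<Longrightarrow> w' \<le> Pos eq d Y (y, e') \<and> w' \<le> ball_le d (y, e') a
          \<and> w' \<le> ball_less d (y, e') b)
      \<Longrightarrow> w' \<le> q"
  shows "w \<le> q"
proof (cases "w = \<bottom>")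
  case False
  obtain x r z s where [simp]: "a = (x, r)" "b = (z, s)" by fastforce
  have ab': "w \<le> ball_le d (x, r) (z, s)" using ab by simp
  from ball_le_pos[OF this] False have rs: "0 < r" "0 < s" by simp_all
  from a have "w \<le> Pos eq d Y (x, r)" by simp
  then show ?thesis
  proof (rule Pos_insideE)
    fix y e w' assume w': "w' \<le> w" "w' \<le> Y y" "0 < e" "w' \<le> d x y (r - e)"
    show "w' \<le> q"
    proof (rule q[OF w'(1), of "e / 2" y])
      show ext: "w' \<le> ext eq y" using w'(4) by (rule d_ext)
      fix e' assume e': "0 < e'" "e' \<le> e / 2"
      have "w' \<le> Pos eq d Y (y, e')"
        by (rule PosI[OF w'(2)]) (rule d_eq[OF ext e'(1)])
      moreover have "w' \<le> ball_le d (y, e') (x, r)"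
        using e'(1) rs(1) by (rule ball_leI) (rule d_mono[OF d_sym[OF w'(4)]], use e' w'(3) in simp)
      moreover have "w' \<le> d y z (s - e')"
      proof -
        have "w' \<le> d x z (s - r + e / 2)"
          by (rule ball_leD[OF order_trans[OF w'(1) ab']]) (use w'(3) in simp)
        from d_triangle[OF d_sym[OF w'(4)] this] show ?thesis
          by (rule d_mono) (use e' in \<open>simp add: field_simps\<close>)
      qed
      ultimately show "w' \<le> Pos eq d Y (y, e') \<and> w' \<le> ball_le d (y, e') a
          \<and> w' \<le> ball_less d (y, e') b"
        using e'(1) rs(2) by simp
    qed (use w'(3) in simp)
  qed
qed simp

text \<open>
  For (M1) a small ball around a point of \<open>Y\<close> is itself a member of the covering family. For (M2)
  the member is the ball of the prescribed radius \<open>r\<close> around that point, and a concentric ball of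
  small enough radius refines both it and the given ball.
\<close>

lemma loc_axioms_pos_cover: "c \<le> loc_axioms eq d (ball.pos_cover (Pos eq d Y))"
  unfolding loc_axioms_def covers_def
proof (intro le_infI forces_all INF_greatest ball.pos_coverI)
  fix u w b w' assume w: "w' \<le> w" "w' \<le> ball_le d b u" "w' \<le> Pos eq d Y b"
  from w(3,2) show "w' \<le> (\<^bold>\<exists>v\<^bold>\<in>(\<lambda>v. ball_less d v u). \<^bold>\<exists>c\<^bold>\<in>Pos eq d Y. ball_le d c b \<^bold>\<and> ball_le d c v)"
  proof (rule Pos_small_ballE)
    fix y e v assume "0 < e" and small: "\<And>e'. 0 < e' \<Longrightarrow> e' \<le> e \<Longrightarrow> v \<le> Pos eq d Y (y, e')
      \<and> v \<le> ball_le d (y, e') b \<and> v \<le> ball_less d (y, e') u"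
    from small[of e] this(1) have e: "v \<le> ball_less d (y, e) u" "v \<le> Pos eq d Y (y, e)" "v \<le> ball_le d (y, e) b"
      by blast+
    from e ball.forces_eq_le[OF ball.le_extD(1)[OF e(3)]]
    show "v \<le> (\<^bold>\<exists>v\<^bold>\<in>(\<lambda>v. ball_less d v u). \<^bold>\<exists>c\<^bold>\<in>Pos eq d Y. ball_le d c b \<^bold>\<and> ball_le d c v)"
      by (rule ball.forces_refinement)
  qed
next
  fix r :: rat and a w b w' assume r: "r \<in> {0<..}"
    and w: "w' \<le> w" "w' \<le> ball_le d b a" "w' \<le> Pos eq d Y b"
  from w(3,2) show "w' \<le> (\<^bold>\<exists>v\<^bold>\<in>(\<lambda>b. \<^bold>\<exists>x\<^bold>\<in>ext eq. ball_eq eq b (x, r)).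
      \<^bold>\<exists>c\<^bold>\<in>Pos eq d Y. ball_le d c b \<^bold>\<and> ball_le d c v)"
  proof (rule Pos_small_ballE)
    fix y e v assume "0 < e" and y: "v \<le> ext eq y"
      and small: "\<And>e'. 0 < e' \<Longrightarrow> e' \<le> e \<Longrightarrow> v \<le> Pos eq d Y (y, e')
        \<and> v \<le> ball_le d (y, e') b \<and> v \<le> ball_less d (y, e') a"
    define e' where "e' = min e r"
    have e': "0 < e'" "e' \<le> e" "e' \<le> r" using \<open>0 < e\<close> r by (auto simp: e'_def)
    have "v \<le> (\<^bold>\<exists>x\<^bold>\<in>ext eq. ball_eq eq (y, r) (x, r))"
      by (rule forces_ex[of _ _ y]) (use y r in auto)
    moreover have "v \<le> ball_le d (y, e') (y, r)"
      by (rule ball_leI) (use e' r in \<open>auto intro: d_eq[OF y]\<close>)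
    ultimately show "v \<le> (\<^bold>\<exists>v\<^bold>\<in>(\<lambda>b. \<^bold>\<exists>x\<^bold>\<in>ext eq. ball_eq eq b (x, r)).
        \<^bold>\<exists>c\<^bold>\<in>Pos eq d Y. ball_le d c b \<^bold>\<and> ball_le d c v)"
      using small[OF e'(1,2)] by (intro ball.forces_refinement[of _ _ "(y, r)" _ "(y, e')"]) blast+
  qed
qed

lemma Pos_positively_closed: "c \<le> positively_closed (ball_eq eq) (loc_cover eq d) (Pos eq d Y)"
  unfolding loc_cover_def
  using Pos_subset Pos_upward loc_axioms_pos_cover
  by (rule ball.positively_closed_least_coveringI[where P = "loc_axioms eq d"])

text \<open>
  If \<open>d x z < t\<close> with \<open>t < s - r\<close>, then \<open>r < s - t\<close>, and locatedness of \<open>Y\<close> can be applied to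
  \<open>x\<close> with these two rationals: a point of \<open>Y\<close> within \<open>s - t\<close> of \<open>x\<close> is within \<open>s\<close> of \<open>z\<close>.
\<close>

lemma located_subset_imp_located_pred:
  assumes Y_loc: "c \<le> located_subset eq d Y"
  shows "c \<le> located_pred eq d (Pos eq d Y)"
  unfolding located_pred_def
proof (intro le_infI Pos_positively_closed forces_all forces_imp)
  fix u w1 v w2 w
  assume st: "w1 \<le> c" "w2 \<le> w1" "w \<le> w2" and vu: "w \<le> ball_less d v u"
  show "w \<le> (\<^bold>\<not> Pos eq d Y v \<^bold>\<or> Pos eq d Y u)"
  proof (cases "w = \<bottom>")
    case False
    obtain x r z s where [simp]: "v = (x, r)" "u = (z, s)" by fastforce
    have xz: "w \<le> d x z (s - r)"
      using vu False by (auto simp: bot_unique split: if_splits)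
    then show ?thesis
    proof (rule d_openE)
      fix t w' assume t: "t < s - r" and w': "w' \<le> w" "w' \<le> d x z t"
      have "w' \<le> located_subset eq d Y" using st w' by (intro order_trans[OF _ Y_loc]) simp
      from forces_allD[OF this[unfolded located_subset_def], OF d_ext(1)[OF w'(2)]]
      have "w' \<le> (\<Sqinter>t\<in>{r<..}. (\<^bold>\<exists>y\<^bold>\<in>Y. d x y t) \<^bold>\<or> \<^bold>\<not> (\<^bold>\<exists>y\<^bold>\<in>Y. d x y r))"
        by (rule forces_INFD) simp
      from forces_INFD[OF this, of "s - t"] t
      have "w' \<le> ((\<^bold>\<exists>y\<^bold>\<in>Y. d x y (s - t)) \<^bold>\<or> \<^bold>\<not> (\<^bold>\<exists>y\<^bold>\<in>Y. d x y r))" by simp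
      then show "w' \<le> (\<^bold>\<not> Pos eq d Y v \<^bold>\<or> Pos eq d Y u)"
      proof (rule forces_orE)
        fix w1 assume w1: "w1 \<le> w'" "w1 \<le> (\<^bold>\<exists>y\<^bold>\<in>Y. d x y (s - t))"
        from w1(2) have "w1 \<le> Pos eq d Y u"
        proof (rule forces_exE)
          fix y w2 assume w2: "w2 \<le> w1" "w2 \<le> Y y" "w2 \<le> d x y (s - t)"
          have "w2 \<le> d z x t" using w2(1) w1(1) by (intro d_sym[OF order_trans[OF _ w'(2)]]) simp
          from d_triangle[OF this w2(3)] have "w2 \<le> d z y s" by simp
          from PosI[OF w2(2) this] show "w2 \<le> Pos eq d Y u" by simp
        qed
        then show "w1 \<le> (\<^bold>\<not> Pos eq d Y v \<^bold>\<or> Pos eq d Y u)" by (rule le_supI2)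
      next
        fix w1 assume no: "w1 \<le> (\<^bold>\<not> (\<^bold>\<exists>y\<^bold>\<in>Y. d x y r))"
        have "w1 \<le> (\<^bold>\<not> Pos eq d Y v)"
        proof (rule forces_imp)
          fix w2 assume w2: "w2 \<le> w1" "w2 \<le> Pos eq d Y v"
          from w2(2) have "w2 \<le> (\<^bold>\<exists>y\<^bold>\<in>Y. d x y r)" unfolding Pos_def by simp
          with order_trans[OF w2(1) no] show "w2 \<le> \<bottom>" by (rule forces_mp)
        qed
        then show "w1 \<le> (\<^bold>\<not> Pos eq d Y v \<^bold>\<or> Pos eq d Y u)" by (rule le_supI1)
      qed
    qed
  qed simp
qed

text \<open>
  The balls of radii \<open>s < t\<close> around one centre \<open>x\<close> are strictly nested. When \<open>s \<le> 0\<close> there is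
  no such ball, but no point has distance less than \<open>s\<close> either. The predicate \<open>F\<close> is kept apart
  from \<open>Pos\<close>, since the two are only known to agree from stage \<open>c\<close> on.
\<close>

lemma located_subset_if_located_pred:
  assumes F: "c \<le> located_pred eq d F"
    and F_Pos: "\<And>w u. w \<le> c \<Longrightarrow> w \<le> F u \<longleftrightarrow> w \<le> Pos eq d Y u"
  shows "c \<le> located_subset eq d Y"
  unfolding located_subset_def
proof (intro forces_all INF_greatest)
  fix x w and s t :: rat assume w: "w \<le> c" "w \<le> ext eq x" and "t \<in> {s<..}"
  then have st: "s < t" by simp
  show "w \<le> ((\<^bold>\<exists>y\<^bold>\<in>Y. d x y t) \<^bold>\<or> \<^bold>\<not> (\<^bold>\<exists>y\<^bold>\<in>Y. d x y s))"
  proof (cases "0 < s")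
    case True
    have "c \<le> (\<^bold>\<forall>u\<^bold>\<in>ext (ball_eq eq). \<^bold>\<forall>v\<^bold>\<in>ext (ball_eq eq). ball_less d v u \<^bold>\<longrightarrow> \<^bold>\<not> F v \<^bold>\<or> F u)"
      using F unfolding located_pred_def by simp
    from forces_allD[OF order_trans[OF w(1) this], of "(x, t)"]
    have "w \<le> (\<^bold>\<forall>v\<^bold>\<in>ext (ball_eq eq). ball_less d v (x, t) \<^bold>\<longrightarrow> \<^bold>\<not> F v \<^bold>\<or> F (x, t))"
      using True st w(2) by simp
    from forces_allD[OF this, of "(x, s)"]
    have "w \<le> (ball_less d (x, s) (x, t) \<^bold>\<longrightarrow> \<^bold>\<not> F (x, s) \<^bold>\<or> F (x, t))"
      using True st w(2) by simp
    moreover have "w \<le> ball_less d (x, s) (x, t)"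
      using True st d_eq[OF w(2)] by simp
    ultimately have "w \<le> (\<^bold>\<not> F (x, s) \<^bold>\<or> F (x, t))" by (rule forces_mp)
    then show ?thesis
    proof (rule forces_orE)
      fix w1 assume w1: "w1 \<le> w" "w1 \<le> (\<^bold>\<not> F (x, s))"
      have "w1 \<le> (\<^bold>\<not> (\<^bold>\<exists>y\<^bold>\<in>Y. d x y s))"
      proof (rule forces_imp)
        fix w2 assume w2: "w2 \<le> w1" "w2 \<le> (\<^bold>\<exists>y\<^bold>\<in>Y. d x y s)"
        from w2(2) have "w2 \<le> Pos eq d Y (x, s)" by (rule forces_exE) (rule PosI)
        then have "w2 \<le> F (x, s)" using F_Pos[of w2] w2(1) w1(1) w(1) by simp
        with order_trans[OF w2(1) w1(2)] show "w2 \<le> \<bottom>" by (rule forces_mp)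
      qed
      then show "w1 \<le> ((\<^bold>\<exists>y\<^bold>\<in>Y. d x y t) \<^bold>\<or> \<^bold>\<not> (\<^bold>\<exists>y\<^bold>\<in>Y. d x y s))" by (rule le_supI2)
    next
      fix w1 assume w1: "w1 \<le> w" "w1 \<le> F (x, t)"
      then have "w1 \<le> Pos eq d Y (x, t)" using F_Pos[of w1] w(1) by simp
      then have "w1 \<le> (\<^bold>\<exists>y\<^bold>\<in>Y. d x y t)" unfolding Pos_def by simp
      then show "w1 \<le> ((\<^bold>\<exists>y\<^bold>\<in>Y. d x y t) \<^bold>\<or> \<^bold>\<not> (\<^bold>\<exists>y\<^bold>\<in>Y. d x y s))" by (rule le_supI1)
    qed
  next
    case False
    have "w \<le> (\<^bold>\<not> (\<^bold>\<exists>y\<^bold>\<in>Y. d x y s))"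
      using False by (intro forces_imp) (auto simp: d_nonpos h_ex_def)
    then show ?thesis by (rule le_supI2)
  qed
qed

text \<open>
  A located predicate defining the sublocale need not exist globally: the supremum only provides
  one at each smaller stage, where it is then identified with \<open>Pos\<close>. In the converse direction
  \<open>Pos\<close> is a global witness.
\<close>

lemma located_sublocale_iff:
  "\<top> \<le> (located_sublocale eq d (loc_sublocale eq d (Pos eq d Y)) \<^bold>\<longleftrightarrow> located_subset eq d Y)"
proof (intro le_infI forces_imp)
  fix w assume "w \<le> located_sublocale eq d (loc_sublocale eq d (Pos eq d Y))"
  then show "w \<le> located_subset eq d Y"
    unfolding located_sublocale_def
  proof (rule forces_SUPE)
    fix F c assume F: "F \<in> subsets (ball_eq eq)" and "c \<le> (located_pred eq d F \<^bold>\<and>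
       covering_subset (ball_eq eq) (loc_sublocale eq d (Pos eq d Y)) (loc_sublocale eq d F) \<^bold>\<and>
       covering_subset (ball_eq eq) (loc_sublocale eq d F) (loc_sublocale eq d (Pos eq d Y)))"
    then have loc: "c \<le> located_pred eq d F"
      and sub1: "c \<le> covering_subset (ball_eq eq) (loc_sublocale eq d (Pos eq d Y)) (loc_sublocale eq d F)"
      and sub2: "c \<le> covering_subset (ball_eq eq) (loc_sublocale eq d F) (loc_sublocale eq d (Pos eq d Y))"
      by simp_all
    have pc: "c \<le> positively_closed (ball_eq eq) (loc_cover eq d) F"
      using loc unfolding located_pred_def by simp
    show "c \<le> located_subset eq d Y"
      using loc
    proof (rule located_subset_if_located_pred)
      fix v u assume v: "v \<le> c"
      note up = order_trans[OF v]
      show "v \<le> F u \<longleftrightarrow> v \<le> Pos eq d Y u"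
      proof
        assume "v \<le> F u"
        show "v \<le> Pos eq d Y u"
          by (rule ball.sublocale_subset_imp_predicate_subset[OF Pos_subset F loc_cover_def
                up[OF pc] up[OF sub1[unfolded loc_sublocale_def]] \<open>v \<le> F u\<close>])
      next
        assume "v \<le> Pos eq d Y u"
        show "v \<le> F u"
          by (rule ball.sublocale_subset_imp_predicate_subset[OF F Pos_subset loc_cover_def
                Pos_positively_closed up[OF sub2[unfolded loc_sublocale_def]] \<open>v \<le> Pos eq d Y u\<close>])
      qed
    qed
  qed
next
  fix w assume w: "w \<le> located_subset eq d Y"
  show "w \<le> located_sublocale eq d (loc_sublocale eq d (Pos eq d Y))"
    unfolding located_sublocale_def
    by (rule forces_SUP[OF Pos_subset])
      (intro le_infI located_subset_imp_located_pred[OF w] covering_subsetI)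
qed

end

end

theorem proposition7:
  fixes eq :: "'x \<Rightarrow> 'x \<Rightarrow> 'h::frame"
    and d :: "'x \<Rightarrow> 'x \<Rightarrow> rat \<Rightarrow> 'h"
    and Y :: "'x \<Rightarrow> 'h"
  assumes "hset eq"
    and "distance_rel eq d"
    and "\<Turnstile> is_metric eq d"
    and "Y \<in> subsets eq"
  shows "\<Turnstile> located_sublocale eq d (loc_sublocale eq d (Pos eq d Y)) \<^bold>\<longleftrightarrow> located_subset eq d Y"
proof -
  interpret hmetric eq d
    using assms(1-3) by unfold_locales
  show ?thesis
    unfolding valid_def by (rule top_le[OF located_sublocale_iff[OF assms(4)]])
qed

end
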